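(* Let either $d=2$ and $A(x_1,x_2)=b(-x_2,x_1)$ with $b\in\mathbb{R}$, or $d=3$ and $A(x)=x\times b$ with $b\in\mathbb{R}^3$. Then the controlled magnetic Schrödinger equation (i.e. with $V=W=0$) $$i\partial_t\psi(t,x)=\big(-\Delta_{A(x)}+u_1(t)|x|^2\big)\psi(t,x),\qquad \psi(0,\cdot)=\psi_0,\qquad x\in\mathbb{R}^d,$$ with real-valued control $u_1$, is not approximately controllable.
   Context: The magnetic Laplacian on $\mathbb{R}^d$ is defined by $-\Delta_A:=-\Delta+|A|^2+i({\rm div}A+2\langle A,\nabla\rangle)$, where $\langle\cdot,\cdot\rangle$ and $|\cdot|$ are the Euclidean inner product and norm; $\times$ is the cross product in $\mathbb{R}^3$. $\mathcal{S}:=\{\psi\in L^2(\mathbb{R}^d,\mathbb{C}) : \|\psi\|_{L^2}=1\}$. $PWC([0,T],\mathbb{R})$ denotes the set of piecewise constant functions $[0,T]\to\mathbb{R}$. For each constant $u_1\in\mathbb{R}$, the operator $-\Delta_A+u_1|x|^2$ with domain $C^\infty_c(\mathbb{R}^d,\mathbb{C})$ is essentially self-adjoint on $L^2(\mathbb{R}^d,\mathbb{C})$. For $u_1\in PWC([0,T],\mathbb{R})$ and $\psi_0\in\mathcal{S}$, the solution $\psi(\cdot;u_1,\psi_0)\in C^0([0,T],\mathcal{S})$ is obtained by composing, on the successive intervals where $u_1$ is constant, the unitary groups $e^{-itH}$ generated by the self-adjoint closures $H$ of these operators. The system is called approximately controllable if, for every $\psi_0,\psi_1\in\mathcal{S}$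 and $\varepsilon>0$, there exist a time $T\geq 0$, a global phase $\theta\in[0,2\pi)$ and a control $u_1\in PWC([0,T],\mathbb{R})$ such that $\|\psi(T;u_1,\psi_0)-e^{i\theta}\psi_1\|_{L^2}<\varepsilon$. *)

theory Defs
  imports "HOL-Analysis.Analysis"
begin

text \<open>
  \<open>L\<^sup>2(\<real>\<^sup>d, \<complex>)\<close> is represented by square-integrable Borel functions; equality in \<open>L\<^sup>2\<close> is
  equality almost everywhere, and \<open>L2_norm\<close> is accordingly a seminorm on representatives.
\<close>

definition L2 :: "(real ^ 'd \<Rightarrow> complex) set" where
  "L2 = {f \<in> borel_measurable lborel. integrable lborel (\<lambda>x. (cmod (f x))\<^sup>2)}"

definition L2_norm :: "(real ^ 'd \<Rightarrow> complex) \<Rightarrow> real" where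
  "L2_norm f = sqrt (\<integral>x. (cmod (f x))\<^sup>2 \<partial>lborel)"

definition L2_dist :: "(real ^ 'd \<Rightarrow> complex) \<Rightarrow> (real ^ 'd \<Rightarrow> complex) \<Rightarrow> real" where
  "L2_dist f g = L2_norm (\<lambda>x. f x - g x)"

definition L2_sphere :: "(real ^ 'd \<Rightarrow> complex) set" where
  "L2_sphere = {f \<in> L2. L2_norm f = 1}"

definition ae_eq :: "(real ^ 'd \<Rightarrow> complex) \<Rightarrow> (real ^ 'd \<Rightarrow> complex) \<Rightarrow> bool" where
  "ae_eq f g \<longleftrightarrow> (AE x in lborel. f x = g x)"

definition partial_deriv ::
    "'d \<Rightarrow> (real ^ 'd \<Rightarrow> 'b::real_normed_vector) \<Rightarrow> real ^ 'd \<Rightarrow> 'b" where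
  "partial_deriv i f x = frechet_derivative f (at x) (axis i 1)"

primrec times_cont_diff :: "nat \<Rightarrow> (real ^ 'd \<Rightarrow> complex) \<Rightarrow> bool" where
  "times_cont_diff 0 f \<longleftrightarrow> continuous_on UNIV f"
| "times_cont_diff (Suc k) f \<longleftrightarrow>
     f differentiable_on UNIV \<and> (\<forall>i. times_cont_diff k (partial_deriv i f))"

definition test_functions :: "(real ^ 'd \<Rightarrow> complex) set" where
  "test_functions = {f. (\<forall>k. times_cont_diff k f) \<and> compact (closure {x. f x \<noteq> 0})}"

definition laplacian :: "(real ^ 'd \<Rightarrow> complex) \<Rightarrow> real ^ 'd \<Rightarrow> complex" where
  "laplacian f x = (\<Sum>i\<in>UNIV. partial_deriv i (partial_deriv i f) x)"

definition divergence :: "(real ^ 'd \<Rightarrow> real ^ 'd) \<Rightarrow> real ^ 'd \<Rightarrow> real" where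
  "divergence A x = (\<Sum>i\<in>UNIV. partial_deriv i (\<lambda>y. A y $ i) x)"

text \<open>The operator \<open>-\<Delta>\<^sub>A = -\<Delta> + |A|\<^sup>2 + i (div A + 2 \<langle>A, \<nabla>\<rangle>)\<close>.\<close>

definition neg_magnetic_laplacian ::
    "(real ^ 'd \<Rightarrow> real ^ 'd) \<Rightarrow> (real ^ 'd \<Rightarrow> complex) \<Rightarrow> real ^ 'd \<Rightarrow> complex" where
  "neg_magnetic_laplacian A f x =
     - laplacian f x + of_real ((norm (A x))\<^sup>2) * f x
     + \<i> * (of_real (divergence A x) * f x
            + 2 * (\<Sum>i\<in>UNIV. of_real (A x $ i) * partial_deriv i f x))"

definition hamiltonian ::
    "(real ^ 'd \<Rightarrow> real ^ 'd) \<Rightarrow> real \<Rightarrow> (real ^ 'd \<Rightarrow> complex) \<Rightarrow> real ^ 'd \<Rightarrow> complex" where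
  "hamiltonian A c f x = neg_magnetic_laplacian A f x + of_real (c * (norm x)\<^sup>2) * f x"

text \<open>Graph of the \<open>L\<^sup>2\<close>-closure of \<open>hamiltonian A c\<close> with domain \<open>test_functions\<close>.\<close>

definition closed_hamiltonian ::
    "(real ^ 'd \<Rightarrow> real ^ 'd) \<Rightarrow> real \<Rightarrow> ((real ^ 'd \<Rightarrow> complex) \<times> (real ^ 'd \<Rightarrow> complex)) set" where
  "closed_hamiltonian A c =
     {(f, g). f \<in> L2 \<and> g \<in> L2 \<and>
        (\<exists>\<phi>. (\<forall>n::nat. \<phi> n \<in> test_functions) \<and>
             (\<lambda>n. L2_dist (\<phi> n) f) \<longlonglongrightarrow> 0 \<and>
             (\<lambda>n. L2_dist (hamiltonian A c (\<phi> n)) g) \<longlonglongrightarrow> 0)}"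

text \<open>
  Strongly continuous one-parameter unitary groups on \<open>L\<^sup>2\<close>. Surjectivity of \<open>U t\<close> and its
  compatibility with almost-everywhere equality follow from the group law, linearity and isometry.
\<close>

definition unitary_group :: "(real \<Rightarrow> (real ^ 'd \<Rightarrow> complex) \<Rightarrow> (real ^ 'd \<Rightarrow> complex)) \<Rightarrow> bool" where
  "unitary_group U \<longleftrightarrow>
     (\<forall>t. \<forall>f\<in>L2. U t f \<in> L2 \<and> L2_norm (U t f) = L2_norm f) \<and>
     (\<forall>t a b. \<forall>f\<in>L2. \<forall>g\<in>L2.
        ae_eq (U t (\<lambda>x. a * f x + b * g x)) (\<lambda>x. a * U t f x + b * U t g x)) \<and>
     (\<forall>f\<in>L2. ae_eq (U 0 f) f) \<and>
     (\<forall>s t. \<forall>f\<in>L2. ae_eq (U (s + t) f) (U s (U t f))) \<and>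
     (\<forall>f\<in>L2. ((\<lambda>t. L2_dist (U t f) f) \<longlongrightarrow> 0) (at 0))"

text \<open>
  Graph of the operator \<open>H\<close> with \<open>U t = e\<^sup>-\<^sup>i\<^sup>t\<^sup>H\<close>: \<open>H f\<close> is the \<open>L\<^sup>2\<close>-limit of \<open>i (U t f - f) / t\<close>
  as \<open>t \<rightarrow> 0\<close>, and the domain consists of all \<open>f\<close> for which this limit exists.
\<close>

definition self_adjoint_generator ::
    "(real \<Rightarrow> (real ^ 'd \<Rightarrow> complex) \<Rightarrow> (real ^ 'd \<Rightarrow> complex)) \<Rightarrow>
     ((real ^ 'd \<Rightarrow> complex) \<times> (real ^ 'd \<Rightarrow> complex)) set" where
  "self_adjoint_generator U =
     {(f, g). f \<in> L2 \<and> g \<in> L2 \<and>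
        ((\<lambda>t. L2_dist (\<lambda>x. \<i> * (U t f x - f x) / of_real t) g) \<longlongrightarrow> 0) (at 0)}"

definition is_schroedinger_group ::
    "(real ^ 'd \<Rightarrow> real ^ 'd) \<Rightarrow> real \<Rightarrow>
     (real \<Rightarrow> (real ^ 'd \<Rightarrow> complex) \<Rightarrow> (real ^ 'd \<Rightarrow> complex)) \<Rightarrow> bool" where
  "is_schroedinger_group A c U \<longleftrightarrow>
     unitary_group U \<and> self_adjoint_generator U = closed_hamiltonian A c"

text \<open>The values of \<open>u\<close> at the finitely many switching times are irrelevant.\<close>

definition is_pieces :: "real \<Rightarrow> (real \<Rightarrow> real) \<Rightarrow> nat \<Rightarrow> (nat \<Rightarrow> real) \<Rightarrow> (nat \<Rightarrow> real) \<Rightarrow> bool" where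
  "is_pieces T u n \<tau> c \<longleftrightarrow>
     \<tau> 0 = 0 \<and> \<tau> n = T \<and>
     (\<forall>i<n. \<tau> i < \<tau> (Suc i) \<and> (\<forall>t\<in>{\<tau> i<..<\<tau> (Suc i)}. u t = c i))"

definition PWC :: "real \<Rightarrow> (real \<Rightarrow> real) set" where
  "PWC T = {u. \<exists>n \<tau> c. is_pieces T u n \<tau> c}"

text \<open>
  The groups exist and are unique up to almost-everywhere equality when the Hamiltonians are
  essentially self-adjoint (Stone's theorem), and then so is the solution, which moreover does not
  depend on the choice of the pieces. Continuity of \<open>\<psi>\<close> in \<open>L\<^sup>2\<close> follows from that of the groups.
\<close>

definition is_solution ::
    "(real ^ 'd \<Rightarrow> real ^ 'd) \<Rightarrow> real \<Rightarrow> (real \<Rightarrow> real) \<Rightarrow> (real ^ 'd \<Rightarrow> complex) \<Rightarrow>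
     (real \<Rightarrow> real ^ 'd \<Rightarrow> complex) \<Rightarrow> bool" where
  "is_solution A T u \<psi>0 \<psi> \<longleftrightarrow>
     (\<forall>t\<in>{0..T}. \<psi> t \<in> L2_sphere) \<and> ae_eq (\<psi> 0) \<psi>0 \<and>
     (\<exists>n \<tau> c. is_pieces T u n \<tau> c \<and>
        (\<forall>i<n. \<exists>U. is_schroedinger_group A (c i) U \<and>
           (\<forall>t\<in>{\<tau> i..\<tau> (Suc i)}. ae_eq (\<psi> t) (U (t - \<tau> i) (\<psi> (\<tau> i))))))"

definition approximately_controllable :: "(real ^ 'd \<Rightarrow> real ^ 'd) \<Rightarrow> bool" where
  "approximately_controllable A \<longleftrightarrow>
     (\<forall>\<psi>0\<in>L2_sphere. \<forall>\<psi>1\<in>L2_sphere. \<forall>\<epsilon>>0.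
        \<exists>T\<ge>0. \<exists>\<theta>\<in>{0..<2 * pi}. \<exists>u\<in>PWC T. \<exists>\<psi>.
          is_solution A T u \<psi>0 \<psi> \<and>
          L2_dist (\<psi> T) (\<lambda>x. exp (\<i> * of_real \<theta>) * \<psi>1 x) < \<epsilon>)"

end

theory Submission
  imports Defs
begin

text \<open>
  The obstruction is parity. A linear vector potential satisfies \<open>A (- x) = - A x\<close> and has constant
  divergence, and \<open>|x|\<^sup>2\<close> is even, so whatever the value of the control, the Hamiltonian commutes
  with the reflection \<open>f \<mapsto> f \<circ> uminus\<close>. An even initial state therefore stays even, whereas an even
  function and an odd function of norm one are always at distance at least one; multiplication by
  a phase keeps an odd function odd. Both potentials are linear, so the result is the case
  \<open>linear_potential_not_controllable\<close>, which holds in every dimension.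

  The Hamiltonian is given only as the closure of its restriction to test functions, and the domains
  for different control values may differ, so one has to show that each group \<open>U\<close> maps
  all even \<open>L\<^sup>2\<close> functions, not only those in the domain of its generator, to even functions.
  This takes three steps.

  First (\<open>commute_reflect_domain\<close>), let \<open>P\<close> be the reflection and \<open>f\<close> in the domain. The norm
  of \<open>w t = U t (P f) - P (U t f)\<close> has derivative zero: \<open>w (t + h)\<close> differs from \<open>U h (w t)\<close>,
  which has the norm of \<open>w t\<close>, by \<open>U h (P u) - P (U h u)\<close> with \<open>u = U t f\<close>, and this is \<open>o(h)\<close>
  because \<open>u\<close> and \<open>P u\<close> lie in the domain and the generator commutes with \<open>P\<close>. As \<open>w 0 = 0\<close>, \<open>U t\<close>
  commutes with \<open>P\<close> on the domain.

  Secondly (\<open>even_part_orthogonal\<close>), if \<open>f\<close> is even and \<open>g\<close> is the odd part of a domain element,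
  then \<open>U (- t) g\<close> is odd, whence \<open>\<parallel>U t f + z g\<parallel> = \<parallel>f + z U (- t) g\<parallel> = \<parallel>f - z U (- t) g\<parallel> =
  \<parallel>U t f - z g\<parallel>\<close> for all complex \<open>z\<close>; by polarization \<open>U t f\<close> is orthogonal to \<open>g\<close>.

  Finally, the domain contains the test functions, and an \<open>L\<^sup>2\<close> function orthogonal to all of
  them vanishes (\<open>L2_orthogonal_test_functions_zero\<close>). The required test functions are products of
  one-dimensional bumps \<open>exp (- c / ((x - a) (b - x)))\<close>, which tend to the indicator function of a
  box as \<open>c\<close> tends to zero; a function whose integrals over all boxes vanish is null.
\<close>

section \<open>The seminorm of \<open>L\<^sup>2\<close>\<close>

lemma L2_measurable: "f \<in> L2 \<Longrightarrow> f \<in> borel_measurable borel"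
  by (simp add: L2_def)

lemma L2_integrable: "f \<in> L2 \<Longrightarrow> integrable lborel (\<lambda>x. (cmod (f x))\<^sup>2)"
  by (simp add: L2_def)

text \<open>
  A weighted form of Minkowski's inequality with free weights: integrated with the weights \<open>s\<close>
  and \<open>t\<close> close to the two norms, it yields the triangle inequality.
\<close>

lemma norm_sum_square_le:
  fixes z w :: "'a::real_normed_vector"
  assumes "s > 0" "t > 0"
  shows "(norm (z + w))\<^sup>2 \<le> (s + t) * ((norm z)\<^sup>2 / s + (norm w)\<^sup>2 / t)"
proof -
  have "(norm (z + w))\<^sup>2 \<le> (norm z + norm w)\<^sup>2"
    by (intro power_mono norm_triangle_ineq norm_ge_zero)
  also have "\<dots> \<le> (s + t) * ((norm z)\<^sup>2 / s + (norm w)\<^sup>2 / t)"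
  proof -
    have "0 \<le> (t * norm z - s * norm w)\<^sup>2 / (s * t)" using assms by simp
    also have "\<dots> = (s + t) * ((norm z)\<^sup>2 / s + (norm w)\<^sup>2 / t) - (norm z + norm w)\<^sup>2"
      using assms by (simp add: field_simps power2_eq_square)
    finally show ?thesis by simp
  qed
  finally show ?thesis .
qed

lemma L2_add:
  fixes f g :: "real ^ 'd \<Rightarrow> complex"
  assumes "f \<in> L2" "g \<in> L2"
  shows "(\<lambda>x. f x + g x) \<in> L2"
proof -
  have [measurable]: "f \<in> borel_measurable borel" "g \<in> borel_measurable borel"
    using assms by (auto intro: L2_measurable)
  have "integrable lborel (\<lambda>x. (cmod (f x + g x))\<^sup>2)"
  proof (rule Bochner_Integration.integrable_bound)
    show "integrable lborel (\<lambda>x. 2 * ((cmod (f x))\<^sup>2 + (cmod (g x))\<^sup>2))"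
      using L2_integrable[OF assms(1)] L2_integrable[OF assms(2)] by simp
    have "(cmod (f x + g x))\<^sup>2 \<le> 2 * ((cmod (f x))\<^sup>2 + (cmod (g x))\<^sup>2)" for x
      using norm_sum_square_le[of 1 1 "f x" "g x"] by simp
    then show "AE x in lborel. norm ((cmod (f x + g x))\<^sup>2)
        \<le> norm (2 * ((cmod (f x))\<^sup>2 + (cmod (g x))\<^sup>2))"
      by simp
  qed measurable
  then show ?thesis by (simp add: L2_def)
qed

lemma L2_mult:
  assumes "f \<in> L2" shows "(\<lambda>x. c * f x) \<in> L2"
proof -
  have [measurable]: "f \<in> borel_measurable borel"
    using assms by (auto intro: L2_measurable)
  show ?thesis
    using L2_integrable[OF assms] by (simp add: L2_def norm_mult power_mult_distrib)
qed

lemma L2_diff: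
  assumes "f \<in> L2" "g \<in> L2" shows "(\<lambda>x. f x - g x) \<in> L2"
  using L2_add[OF assms(1) L2_mult[OF assms(2), of "-1"]] by simp

lemma L2_lincomb:
  assumes "f \<in> L2" "g \<in> L2" shows "(\<lambda>x. a * f x + b * g x) \<in> L2"
  by (intro L2_add L2_mult assms)

lemma L2_norm_nonneg: "0 \<le> L2_norm f"
  by (simp add: L2_norm_def)

lemma L2_norm_square: "(L2_norm f)\<^sup>2 = (\<integral>x. (cmod (f x))\<^sup>2 \<partial>lborel)"
  by (simp add: L2_norm_def)

lemma L2_norm_mult: "L2_norm (\<lambda>x. c * f x) = cmod c * L2_norm f"
  by (simp add: L2_norm_def norm_mult power_mult_distrib real_sqrt_mult)

lemma L2_norm_cong_AE:
  assumes "f \<in> L2" "g \<in> L2" "ae_eq f g"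
  shows "L2_norm f = L2_norm g"
proof -
  have [measurable]: "f \<in> borel_measurable borel" "g \<in> borel_measurable borel"
    using assms by (auto intro: L2_measurable)
  show ?thesis
    unfolding L2_norm_def using assms(3)
    by (intro arg_cong[where f = sqrt] integral_cong_AE) (auto simp: ae_eq_def)
qed

lemma L2_norm_eq_0_iff:
  assumes "f \<in> L2"
  shows "L2_norm f = 0 \<longleftrightarrow> ae_eq f (\<lambda>x. 0)"
  unfolding L2_norm_def ae_eq_def
  using integral_nonneg_eq_0_iff_AE[OF L2_integrable[OF assms]] by simp

text \<open>
  The weights in \<open>norm_sum_square_le\<close> should be the norms themselves; these may vanish, so
  they are enlarged by an arbitrarily small amount.
\<close>

lemma L2_norm_triangle:
  assumes "f \<in> L2" "g \<in> L2"
  shows "L2_norm (\<lambda>x. f x + g x) \<le> L2_norm f + L2_norm g"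
proof (rule field_le_epsilon)
  fix e :: real assume "e > 0"
  define s where "s = L2_norm f + e / 2"
  define t where "t = L2_norm g + e / 2"
  have st: "s > 0" "t > 0" "L2_norm f \<le> s" "L2_norm g \<le> t"
    using \<open>e > 0\<close> L2_norm_nonneg[of f] L2_norm_nonneg[of g] by (auto simp: s_def t_def)
  have "(L2_norm (\<lambda>x. f x + g x))\<^sup>2
      \<le> (\<integral>x. (s + t) * ((cmod (f x))\<^sup>2 / s + (cmod (g x))\<^sup>2 / t) \<partial>lborel)"
    unfolding L2_norm_square
  proof (rule integral_mono)
    show "integrable lborel (\<lambda>x. (cmod (f x + g x))\<^sup>2)"
      by (rule L2_integrable[OF L2_add[OF assms]])
    show "integrable lborel (\<lambda>x. (s + t) * ((cmod (f x))\<^sup>2 / s + (cmod (g x))\<^sup>2 / t))"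
      using L2_integrable[OF assms(1)] L2_integrable[OF assms(2)] by simp
  qed (rule norm_sum_square_le[OF st(1,2)])
  also have "\<dots> = (s + t) * ((L2_norm f)\<^sup>2 / s + (L2_norm g)\<^sup>2 / t)"
    unfolding L2_norm_square using L2_integrable[OF assms(1)] L2_integrable[OF assms(2)] by simp
  also have "\<dots> \<le> (s + t) * (s\<^sup>2 / s + t\<^sup>2 / t)"
    using st L2_norm_nonneg
    by (intro mult_left_mono add_mono divide_right_mono power_mono) auto
  also have "\<dots> = (s + t)\<^sup>2" using st by (simp add: power2_eq_square)
  finally have "L2_norm (\<lambda>x. f x + g x) \<le> s + t"
    using st by (auto intro: power2_le_imp_le)
  then show "L2_norm (\<lambda>x. f x + g x) \<le> L2_norm f + L2_norm g + e"
    by (simp add: s_def t_def)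
qed

lemma L2_norm_triangle_sub:
  assumes "f \<in> L2" "g \<in> L2"
  shows "\<bar>L2_norm f - L2_norm g\<bar> \<le> L2_dist f g"
proof -
  have "L2_norm f \<le> L2_norm (\<lambda>x. f x - g x) + L2_norm g"
    using L2_norm_triangle[OF L2_diff[OF assms] assms(2)] by simp
  moreover have "L2_norm g \<le> L2_norm (\<lambda>x. g x - f x) + L2_norm f"
    using L2_norm_triangle[OF L2_diff[OF assms(2,1)] assms(1)] by simp
  moreover have "L2_norm (\<lambda>x. g x - f x) = L2_norm (\<lambda>x. f x - g x)"
    using L2_norm_mult[of "-1" "\<lambda>x. f x - g x"] by simp
  ultimately show ?thesis unfolding L2_dist_def by linarith
qed

lemma L2_norm_triangle_minus:
  assumes "f \<in> L2" "g \<in> L2"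
  shows "L2_norm (\<lambda>x. f x - g x) \<le> L2_norm f + L2_norm g"
  using L2_norm_triangle[OF assms(1) L2_mult[OF assms(2), of "-1"]] L2_norm_mult[of "-1" g] by simp

lemma ae_eq_trans [trans]: "ae_eq f g \<Longrightarrow> ae_eq g h \<Longrightarrow> ae_eq f h"
  unfolding ae_eq_def by (elim AE_mp) auto

lemma ae_eq_sym: "ae_eq f g \<Longrightarrow> ae_eq g f"
  unfolding ae_eq_def by (elim AE_mp) auto

lemma ae_eq_iff_L2_dist:
  assumes "f \<in> L2" "g \<in> L2"
  shows "ae_eq f g \<longleftrightarrow> L2_dist f g = 0"
  unfolding L2_dist_def L2_norm_eq_0_iff[OF L2_diff[OF assms]] by (simp add: ae_eq_def)

lemma L2_product_integrable:
  fixes u v :: "real ^ 'd \<Rightarrow> complex"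
  assumes "u \<in> L2" "v \<in> L2"
  shows "integrable lborel (\<lambda>x. u x * cnj (v x))"
proof (rule Bochner_Integration.integrable_bound)
  have [measurable]: "u \<in> borel_measurable borel" "v \<in> borel_measurable borel"
    using assms by (auto intro: L2_measurable)
  have [measurable]: "cnj \<in> borel_measurable borel"
    by (intro borel_measurable_continuous_onI continuous_intros)
  show "(\<lambda>x. u x * cnj (v x)) \<in> borel_measurable lborel"
    by measurable
  show "integrable lborel (\<lambda>x. (cmod (u x))\<^sup>2 + (cmod (v x))\<^sup>2)"
    using L2_integrable[OF assms(1)] L2_integrable[OF assms(2)] by simp
  have "r * s \<le> r\<^sup>2 + s\<^sup>2" if "r \<ge> 0" "s \<ge> 0" for r s :: real
    using sum_squares_bound[of r s] mult_nonneg_nonneg[OF that] by linarith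
  then show "AE x in lborel. norm (u x * cnj (v x)) \<le> norm ((cmod (u x))\<^sup>2 + (cmod (v x))\<^sup>2)"
    by (simp add: norm_mult)
qed

text \<open>
  Polarization: \<open>|p + z q|\<^sup>2 - |p - z q|\<^sup>2 = 4 Re (cnj z * p * cnj q)\<close>, with \<open>z = 1\<close> and \<open>z = \<i>\<close>
  for the real and the imaginary part.
\<close>

lemma L2_orthogonal_if_norm_symmetric:
  fixes u v :: "real ^ 'd \<Rightarrow> complex"
  assumes "u \<in> L2" "v \<in> L2"
    and sym: "\<And>z. L2_norm (\<lambda>x. u x + z * v x) = L2_norm (\<lambda>x. u x - z * v x)"
  shows "(\<integral>x. u x * cnj (v x) \<partial>lborel) = 0"
proof -
  define I where "I = (\<integral>x. u x * cnj (v x) \<partial>lborel)"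
  have "Re (cnj z * I) = 0" for z
  proof -
    have polar: "(cmod (p + z * q))\<^sup>2 - (cmod (p - z * q))\<^sup>2 = 4 * Re (cnj z * (p * cnj q))" for p q
      unfolding cmod_power2 by (simp add: power2_eq_square algebra_simps)
    have "(\<integral>x. 4 * Re (cnj z * (u x * cnj (v x))) \<partial>lborel)
        = (\<integral>x. (cmod (u x + z * v x))\<^sup>2 - (cmod (u x - z * v x))\<^sup>2 \<partial>lborel)"
      by (simp only: polar)
    also have "\<dots> = (L2_norm (\<lambda>x. u x + z * v x))\<^sup>2 - (L2_norm (\<lambda>x. u x - z * v x))\<^sup>2"
      unfolding L2_norm_square
      by (intro Bochner_Integration.integral_diff L2_integrable L2_add L2_diff L2_mult assms)
    also have "\<dots> = 0" by (simp add: sym)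
    finally have "4 * (\<integral>x. Re (cnj z * (u x * cnj (v x))) \<partial>lborel) = 0"
      by (simp only: integral_mult_right_zero)
    then have "(\<integral>x. Re (cnj z * (u x * cnj (v x))) \<partial>lborel) = 0"
      by linarith
    moreover have "(\<integral>x. Re (cnj z * (u x * cnj (v x))) \<partial>lborel)
        = Re (\<integral>x. cnj z * (u x * cnj (v x)) \<partial>lborel)"
      by (intro integral_Re integrable_mult_right L2_product_integrable assms)
    ultimately show ?thesis by (simp only: integral_mult_right_zero I_def)
  qed
  from this[of 1] this[of \<i>] show ?thesis by (simp add: I_def[symmetric] complex_eq_iff)
qed

section \<open>Reflection of functions\<close>

definition reflect :: "(real ^ 'd \<Rightarrow> 'b) \<Rightarrow> real ^ 'd \<Rightarrow> 'b" where
  "reflect f = (\<lambda>x. f (- x))"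

lemma lborel_distr_uminus_vec: "distr lborel borel uminus = (lborel :: (real ^ 'd) measure)"
proof -
  have "(lborel :: (real ^ 'd) measure) = density (distr lborel borel uminus) (\<lambda>_. 1)"
    using lborel_affine[of "-1" "0 :: real ^ 'd"] by simp
  then show ?thesis by (simp add: density_1)
qed

lemma AE_reflect:
  assumes "AE x in lborel. P (x :: real ^ 'd)" shows "AE x in lborel. P (- x)"
proof -
  obtain N where N: "{x. \<not> P x} \<subseteq> N" "N \<in> sets lborel" "emeasure lborel N = 0"
    using AE_E[OF assms] by auto
  have "emeasure lborel (uminus -` N) = emeasure (distr lborel borel uminus) N"
    using N by (subst emeasure_distr) auto
  then have "emeasure lborel (uminus -` N) = 0"
    using N(3) by (simp add: lborel_distr_uminus_vec)
  moreover have "uminus -` N \<in> sets (borel :: (real ^ 'd) measure)"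
    using measurable_sets[of uminus borel borel N] N(2) by simp
  ultimately show ?thesis
    using N(1) by (intro AE_I[of _ _ "uminus -` N"]) auto
qed

lemma integrable_reflect:
  fixes f :: "real ^ 'd \<Rightarrow> 'b::{banach, second_countable_topology}"
  assumes "integrable lborel f"
  shows "integrable lborel (\<lambda>x. f (- x))"
  using integrable_distr[of uminus lborel borel f] assms by (simp add: lborel_distr_uminus_vec)

lemma integral_reflect_lborel:
  fixes f :: "real ^ 'd \<Rightarrow> 'b::{banach, second_countable_topology}"
  shows "(\<integral>x. f (- x) \<partial>lborel) = (\<integral>x. f x \<partial>lborel)"
proof (cases "integrable lborel f")
  case True
  then show ?thesis
    using integral_distr[of uminus lborel borel f] by (simp add: lborel_distr_uminus_vec)
next
  case False
  moreover have "\<not> integrable lborel (\<lambda>x. f (- x))"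
    using False integrable_reflect[of "\<lambda>x. f (- x)"] by auto
  ultimately show ?thesis by (simp add: not_integrable_integral_eq)
qed

lemma L2_reflect: "f \<in> L2 \<Longrightarrow> reflect f \<in> L2"
  unfolding L2_def reflect_def using integrable_reflect[of "\<lambda>x. (cmod (f x))\<^sup>2"] by auto

lemma L2_norm_reflect: "L2_norm (reflect f) = L2_norm f"
  unfolding L2_norm_def reflect_def using integral_reflect_lborel[of "\<lambda>x. (cmod (f x))\<^sup>2"] by simp

lemma L2_dist_reflect: "L2_dist (reflect f) (reflect g) = L2_dist f g"
  unfolding L2_dist_def using L2_norm_reflect[of "\<lambda>x. f x - g x"] by (simp add: reflect_def)

lemma ae_eq_reflect: "ae_eq f g \<Longrightarrow> ae_eq (reflect f) (reflect g)"
  unfolding ae_eq_def reflect_def by (rule AE_reflect)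

text \<open>
  Reflection turns \<open>f + g\<close> into \<open>f - g\<close> and preserves the norm.
\<close>

lemma L2_norm_add_eq_diff:
  assumes "f \<in> L2" "g \<in> L2" "ae_eq (reflect f) f" "ae_eq (reflect g) (\<lambda>x. - g x)"
  shows "L2_norm (\<lambda>x. f x + g x) = L2_norm (\<lambda>x. f x - g x)"
proof -
  have "L2_norm (\<lambda>x. f x + g x) = L2_norm (reflect (\<lambda>x. f x + g x))"
    by (simp add: L2_norm_reflect)
  also have "\<dots> = L2_norm (\<lambda>x. f x - g x)"
    using assms(3,4) by (intro L2_norm_cong_AE L2_reflect L2_add L2_diff assms(1,2))
      (auto simp: ae_eq_def reflect_def)
  finally show ?thesis .
qed

section \<open>Unitary groups whose generator commutes with the reflection\<close>

locale one_parameter_unitary_group =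
  fixes U :: "real \<Rightarrow> (real ^ 'd \<Rightarrow> complex) \<Rightarrow> (real ^ 'd \<Rightarrow> complex)"
  assumes unitary: "unitary_group U"
begin

lemma U_L2: "f \<in> L2 \<Longrightarrow> U t f \<in> L2"
  using unitary by (simp add: unitary_group_def)

lemma U_norm: "f \<in> L2 \<Longrightarrow> L2_norm (U t f) = L2_norm f"
  using unitary by (simp add: unitary_group_def)

lemma U_linear: "f \<in> L2 \<Longrightarrow> g \<in> L2 \<Longrightarrow>
    ae_eq (U t (\<lambda>x. a * f x + b * g x)) (\<lambda>x. a * U t f x + b * U t g x)"
  using unitary by (simp add: unitary_group_def)

lemma U_diff:
  assumes "f \<in> L2" "g \<in> L2"
  shows "ae_eq (U t (\<lambda>x. f x - g x)) (\<lambda>x. U t f x - U t g x)"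
  using U_linear[OF assms, of t 1 "-1"] by simp

lemma U_zero: "f \<in> L2 \<Longrightarrow> ae_eq (U 0 f) f"
  using unitary by (simp add: unitary_group_def)

lemma U_add: "f \<in> L2 \<Longrightarrow> ae_eq (U (s + t) f) (U s (U t f))"
  using unitary by (simp add: unitary_group_def)

lemma U_commute: "f \<in> L2 \<Longrightarrow> ae_eq (U s (U t f)) (U t (U s f))"
  using ae_eq_trans[OF ae_eq_sym[OF U_add[of f s t]] U_add[of f t s, unfolded add.commute[of t s]]]
  by simp

lemma U_dist:
  assumes "f \<in> L2" "g \<in> L2"
  shows "L2_dist (U t f) (U t g) = L2_dist f g"
proof -
  have "L2_dist (U t f) (U t g) = L2_norm (U t (\<lambda>x. f x - g x))"
    unfolding L2_dist_def
    by (intro L2_norm_cong_AE U_L2 L2_diff assms ae_eq_sym[OF U_diff])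
  then show ?thesis by (simp add: U_norm L2_diff assms L2_dist_def)
qed

text \<open>
  Since \<open>U s\<close> is isometric and commutes with \<open>U t\<close>, it carries the difference quotient of
  \<open>f\<close> to that of \<open>U s f\<close>.
\<close>

lemma generator_invariant:
  assumes "(f, g) \<in> self_adjoint_generator U"
  shows "(U s f, U s g) \<in> self_adjoint_generator U"
proof -
  have fg: "f \<in> L2" "g \<in> L2"
    and lim: "((\<lambda>t. L2_dist (\<lambda>x. \<i> * (U t f x - f x) / of_real t) g) \<longlongrightarrow> 0) (at 0)"
    using assms by (auto simp: self_adjoint_generator_def)
  have eq: "L2_dist (\<lambda>x. \<i> * (U t (U s f) x - U s f x) / of_real t) (U s g)
      = L2_dist (\<lambda>x. \<i> * (U t f x - f x) / of_real t) g" for t :: real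
  proof -
    define k where "k = \<i> / complex_of_real t"
    define d where "d = (\<lambda>x. k * U t f x + (- k) * f x)"
    have d: "d \<in> L2" unfolding d_def by (intro L2_lincomb U_L2 fg)
    have d': "(\<lambda>x. k * U t (U s f) x + (- k) * U s f x) \<in> L2"
      by (intro L2_lincomb U_L2 fg)
    have "ae_eq (\<lambda>x. k * U t (U s f) x + (- k) * U s f x) (U s d)"
      using U_linear[OF U_L2[OF fg(1)] fg(1), of s k t "- k"] U_commute[OF fg(1), of t s]
      unfolding ae_eq_def d_def by (elim AE_mp) auto
    then have "L2_dist (\<lambda>x. k * U t (U s f) x + (- k) * U s f x) (U s g) = L2_dist (U s d) (U s g)"
      unfolding L2_dist_def
      by (intro L2_norm_cong_AE L2_diff U_L2 fg d d') (auto simp: ae_eq_def)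
    also have "\<dots> = L2_dist d g" by (intro U_dist fg d)
    finally show ?thesis by (simp add: d_def k_def algebra_simps diff_divide_distrib)
  qed
  show ?thesis
    unfolding self_adjoint_generator_def using lim by (simp add: fg U_L2 eq)
qed

text \<open>
  The defect \<open>U s (reflect f) - reflect (U s f)\<close> has constant norm. This is the usual argument for
  the uniqueness of the group with a given generator, applied to \<open>U\<close> and its conjugate by the reflection.
\<close>

lemma commute_reflect_domain:
  assumes sym: "\<And>f g. (f, g) \<in> self_adjoint_generator U \<Longrightarrow>
      (reflect f, reflect g) \<in> self_adjoint_generator U"
    and fg: "(f, g) \<in> self_adjoint_generator U"
  shows "ae_eq (U t (reflect f)) (reflect (U t f))"
proof -
  define F where "F s = L2_dist (U s (reflect f)) (reflect (U s f))" for s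
  have f: "f \<in> L2" "reflect f \<in> L2"
    using fg by (auto simp: self_adjoint_generator_def L2_reflect)
  have "(F has_real_derivative 0) (at s)" for s
  proof -
    define u where "u = U s f"
    define v where "v = U s g"
    have "(u, v) \<in> self_adjoint_generator U"
      unfolding u_def v_def by (rule generator_invariant[OF fg])
    note uv = this sym[OF this]
    have u: "u \<in> L2" "v \<in> L2" "reflect u \<in> L2" "reflect v \<in> L2"
      using uv(1) by (auto simp: self_adjoint_generator_def L2_reflect)
    define e1 where "e1 h = L2_dist (\<lambda>x. \<i> * (U h (reflect u) x - reflect u x) / of_real h) (reflect v)" for h
    define e2 where "e2 h = L2_dist (\<lambda>x. \<i> * (U h u x - u x) / of_real h) v" for h
    have "((\<lambda>h. e1 h + e2 h) \<longlongrightarrow> 0 + 0) (at 0)"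
      using uv unfolding e1_def e2_def self_adjoint_generator_def
      by (intro tendsto_add) auto
    then have e: "((\<lambda>h. e1 h + e2 h) \<longlongrightarrow> 0) (at 0)" by simp
    \<comment> \<open>\<open>F s\<close> is also the norm of \<open>U h (w s)\<close>, so only the distance from \<open>w (s + h)\<close> to it matters.\<close>
    have step: "\<bar>F (s + h) - F s\<bar> \<le> L2_dist (U h (reflect u)) (reflect (U h u))" for h
    proof -
      define w where "w = (\<lambda>x. U s (reflect f) x - reflect u x)"
      define w' where "w' = (\<lambda>x. U (s + h) (reflect f) x - reflect (U (s + h) f) x)"
      have w: "w \<in> L2" "w' \<in> L2"
        unfolding w_def w'_def by (intro L2_diff L2_reflect U_L2 f u)+
      have "F s = L2_norm (U h w)"
        unfolding U_norm[OF w(1)] by (simp add: F_def L2_dist_def w_def u_def)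
      moreover have "F (s + h) = L2_norm w'" by (simp add: F_def L2_dist_def w'_def)
      ultimately have "\<bar>F (s + h) - F s\<bar> \<le> L2_dist w' (U h w)"
        using L2_norm_triangle_sub[OF w(2) U_L2[OF w(1)], of h] by simp
      also have "\<dots> = L2_norm (\<lambda>x. U h (reflect u) x - reflect (U h u) x)"
        unfolding L2_dist_def
      proof (intro L2_norm_cong_AE L2_diff U_L2 L2_reflect w u)
        have 1: "ae_eq (U h w) (\<lambda>x. U h (U s (reflect f)) x - U h (reflect u) x)"
          unfolding w_def by (intro U_diff U_L2 f u)
        have 2: "ae_eq (U (s + h) (reflect f)) (U h (U s (reflect f)))"
          using U_add[OF f(2), of h s] by (simp add: add.commute)
        have 3: "ae_eq (reflect (U (s + h) f)) (reflect (U h u))"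
          unfolding u_def using ae_eq_reflect[OF U_add[OF f(1), of h s]] by (simp add: add.commute)
        show "ae_eq (\<lambda>x. w' x - U h w x) (\<lambda>x. U h (reflect u) x - reflect (U h u) x)"
          using 1 2 3 unfolding ae_eq_def w'_def by (elim AE_mp) auto
      qed
      finally show ?thesis by (simp add: L2_dist_def)
    qed
    \<comment> \<open>The defect of \<open>u\<close> at time \<open>h\<close> is \<open>o(h)\<close>: the two first-order terms cancel.\<close>
    have small: "L2_dist (U h (reflect u)) (reflect (U h u)) / \<bar>h\<bar> \<le> e1 h + e2 h" if "h \<noteq> 0" for h
    proof -
      define k where "k = \<i> / complex_of_real h"
      define d1 where "d1 = (\<lambda>x. (k * U h (reflect u) x + (- k) * reflect u x) - reflect v x)"
      define d2 where "d2 = (\<lambda>x. (k * U h u x + (- k) * u x) - v x)"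
      have d: "d1 \<in> L2" "d2 \<in> L2"
        unfolding d1_def d2_def by (intro L2_diff L2_lincomb U_L2 u)+
      have "L2_dist (U h (reflect u)) (reflect (U h u)) / \<bar>h\<bar>
          = cmod k * L2_norm (\<lambda>x. U h (reflect u) x - reflect (U h u) x)"
        by (simp add: k_def norm_divide L2_dist_def)
      also have "\<dots> = L2_norm (\<lambda>x. d1 x - reflect d2 x)"
        unfolding L2_norm_mult[symmetric] by (simp add: d1_def d2_def reflect_def algebra_simps)
      also have "\<dots> \<le> L2_norm d1 + L2_norm (reflect d2)"
        by (intro L2_norm_triangle_minus L2_reflect d)
      also have "\<dots> = e1 h + e2 h"
        unfolding L2_norm_reflect e1_def e2_def L2_dist_def
        by (simp add: d1_def d2_def k_def algebra_simps diff_divide_distrib)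
      finally show ?thesis .
    qed
    have "((\<lambda>h. (F (s + h) - F s) / h) \<longlongrightarrow> 0) (at 0)"
    proof (rule Lim_null_comparison[OF _ e])
      have "norm ((F (s + h) - F s) / h) \<le> e1 h + e2 h" if "h \<noteq> 0" for h
        using divide_right_mono[OF step[of h], of "\<bar>h\<bar>"] small[OF that] by simp
      then show "\<forall>\<^sub>F h in at 0. norm ((F (s + h) - F s) / h) \<le> e1 h + e2 h"
        by (auto simp: eventually_at_filter)
    qed
    then show ?thesis by (simp add: DERIV_def)
  qed
  then have "F t = F 0" by (intro DERIV_isconst_all) simp
  also have "F 0 = 0"
    unfolding F_def
    using ae_eq_trans[OF U_zero[OF f(2)] ae_eq_sym[OF ae_eq_reflect[OF U_zero[OF f(1)]]]]
    by (subst ae_eq_iff_L2_dist[symmetric]) (auto intro: U_L2 L2_reflect f)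
  finally show ?thesis
    by (subst ae_eq_iff_L2_dist) (auto simp: F_def intro: U_L2 L2_reflect f)
qed

end

text \<open>
  The passage from the domain to all even \<open>f\<close> is by duality: \<open>U (- t)\<close> acts on the test
  element \<open>\<phi>\<close>, which does lie in the domain.
\<close>

lemma (in one_parameter_unitary_group) even_part_orthogonal:
  assumes sym: "\<And>f g. (f, g) \<in> self_adjoint_generator U \<Longrightarrow>
      (reflect f, reflect g) \<in> self_adjoint_generator U"
    and \<phi>: "(\<phi>, \<eta>) \<in> self_adjoint_generator U"
    and f: "f \<in> L2" "ae_eq (reflect f) f"
  shows "(\<integral>x. (U t f x - reflect (U t f) x) * cnj (\<phi> x) \<partial>lborel) = 0"
proof -
  have \<phi>_L2: "\<phi> \<in> L2" "reflect \<phi> \<in> L2"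
    using \<phi> by (auto simp: self_adjoint_generator_def L2_reflect)
  define g where "g = (\<lambda>x. \<phi> x - reflect \<phi> x)"
  have g: "g \<in> L2" unfolding g_def by (intro L2_diff \<phi>_L2)
  define v where "v = U (- t) g"
  have v: "v \<in> L2" unfolding v_def by (intro U_L2 g)
  have v_eq: "ae_eq v (\<lambda>x. U (- t) \<phi> x - reflect (U (- t) \<phi>) x)"
    using U_diff[OF \<phi>_L2, of "- t"] commute_reflect_domain[OF sym \<phi>, of "- t"]
    unfolding v_def g_def ae_eq_def by (elim AE_mp) auto
  have v_odd: "ae_eq (reflect v) (\<lambda>x. - v x)"
    using v_eq ae_eq_reflect[OF v_eq] unfolding ae_eq_def reflect_def by (elim AE_mp) auto
  have shift: "L2_norm (\<lambda>x. U t f x + z * g x) = L2_norm (\<lambda>x. f x + z * v x)" for z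
  proof -
    have "L2_norm (\<lambda>x. U t f x + z * g x) = L2_norm (U (- t) (\<lambda>x. U t f x + z * g x))"
      by (intro U_norm[symmetric] L2_add L2_mult U_L2 f g)
    also have "\<dots> = L2_norm (\<lambda>x. f x + z * v x)"
    proof (intro L2_norm_cong_AE U_L2 L2_add L2_mult f g v)
      have "ae_eq (U (- t) (\<lambda>x. U t f x + z * g x)) (\<lambda>x. U (- t) (U t f) x + z * v x)"
        using U_linear[OF U_L2[OF f(1)] g, of "- t" 1 t z] by (simp add: v_def)
      moreover have "ae_eq (U (- t) (U t f)) f"
        using ae_eq_trans[OF ae_eq_sym[OF U_add[OF f(1), of "- t" t]]] U_zero[OF f(1)] by simp
      ultimately show "ae_eq (U (- t) (\<lambda>x. U t f x + z * g x)) (\<lambda>x. f x + z * v x)"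
        unfolding ae_eq_def by (elim AE_mp) auto
    qed
    finally show ?thesis .
  qed
  have "L2_norm (\<lambda>x. U t f x + z * g x) = L2_norm (\<lambda>x. U t f x - z * g x)" for z
  proof -
    have "ae_eq (reflect (\<lambda>x. z * v x)) (\<lambda>x. - (z * v x))"
      using v_odd unfolding ae_eq_def reflect_def by (elim AE_mp) auto
    then have "L2_norm (\<lambda>x. f x + z * v x) = L2_norm (\<lambda>x. f x - z * v x)"
      by (intro L2_norm_add_eq_diff f L2_mult v)
    then show ?thesis using shift[of z] shift[of "- z"] by simp
  qed
  then have "0 = (\<integral>x. U t f x * cnj (g x) \<partial>lborel)"
    by (intro L2_orthogonal_if_norm_symmetric[symmetric] U_L2 f g)
  also have "\<dots> = (\<integral>x. U t f x * cnj (\<phi> x) - U t f x * cnj (reflect \<phi> x) \<partial>lborel)"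
    by (simp add: g_def algebra_simps)
  also have "\<dots> = (\<integral>x. U t f x * cnj (\<phi> x) \<partial>lborel) - (\<integral>x. U t f x * cnj (reflect \<phi> x) \<partial>lborel)"
    by (intro Bochner_Integration.integral_diff L2_product_integrable U_L2 f \<phi>_L2)
  also have "(\<integral>x. U t f x * cnj (reflect \<phi> x) \<partial>lborel) = (\<integral>x. reflect (U t f) x * cnj (\<phi> x) \<partial>lborel)"
    using integral_reflect_lborel[of "\<lambda>x. U t f x * cnj (reflect \<phi> x)"] by (simp add: reflect_def)
  also have "(\<integral>x. U t f x * cnj (\<phi> x) \<partial>lborel) - (\<integral>x. reflect (U t f) x * cnj (\<phi> x) \<partial>lborel)
      = (\<integral>x. U t f x * cnj (\<phi> x) - reflect (U t f) x * cnj (\<phi> x) \<partial>lborel)"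
    by (intro Bochner_Integration.integral_diff[symmetric] L2_product_integrable L2_reflect U_L2 f \<phi>_L2)
  finally show ?thesis by (simp add: left_diff_distrib)
qed

section \<open>Smooth bump functions on boxes\<close>

text \<open>
  The bump itself is the case \<open>p = 1\<close>, \<open>m = 0\<close>. The factor \<open>p / q ^ m\<close> makes the family closed
  under differentiation, which gives smoothness without computing any higher derivative.
\<close>

definition bump :: "real \<Rightarrow> real \<Rightarrow> real \<Rightarrow> real poly \<Rightarrow> nat \<Rightarrow> real \<Rightarrow> real" where
  "bump c a b p m x =
     (if a < x \<and> x < b
      then poly p x / ((x - a) * (b - x)) ^ m * exp (- c / ((x - a) * (b - x))) else 0)"

text \<open>
  The numerator of the derivative of \<open>p / Q ^ m * exp (- c / Q)\<close> over the denominator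
  \<open>Q ^ (m + 2)\<close>.
\<close>

definition bump_deriv_poly :: "real \<Rightarrow> real \<Rightarrow> real \<Rightarrow> real poly \<Rightarrow> nat \<Rightarrow> real poly" where
  "bump_deriv_poly c a b p m =
     (let Q = [:- a, 1:] * [:b, - 1:]
      in pderiv p * Q\<^sup>2 - smult (real m) (p * pderiv Q * Q) + smult c (p * pderiv Q))"

text \<open>
  Raise \<open>y \<le> exp y\<close> to the power \<open>k\<close> at \<open>y = c / (k q)\<close>.
\<close>

lemma exp_minus_divide_le_power:
  fixes c q :: real
  assumes "c > 0" "q > 0" "k > 0"
  shows "exp (- c / q) \<le> (real k * q / c) ^ k"
proof -
  define y where "y = c / (real k * q)"
  have "y > 0" using assms by (simp add: y_def)
  have "y ^ k \<le> exp y ^ k"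
    using exp_ge_add_one_self[of y] \<open>y > 0\<close> by (intro power_mono) linarith+
  also have "\<dots> = exp (c / q)"
    using assms by (simp add: exp_of_nat_mult[symmetric] y_def)
  finally have "exp (- (c / q)) \<le> inverse (y ^ k)"
    unfolding exp_minus using \<open>y > 0\<close> by (intro le_imp_inverse_le) auto
  also have "\<dots> = (real k * q / c) ^ k"
    by (simp add: y_def power_inverse[symmetric])
  finally show ?thesis by simp
qed

text \<open>
  The exponential beats the pole with two powers to spare; these two powers make the derivative
  vanish at the end points.
\<close>

lemma bump_bound:
  assumes "c > 0"
  obtains C where "C \<ge> 0" "\<And>x. a < x \<Longrightarrow> x < b \<Longrightarrow> \<bar>bump c a b p m x\<bar> \<le> C * ((x - a) * (b - x))\<^sup>2"
proof -
  have "bounded (poly p ` {a..b})"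
    by (intro compact_imp_bounded compact_continuous_image continuous_intros) auto
  then obtain M where M: "M > 0" "\<And>x. x \<in> {a..b} \<Longrightarrow> \<bar>poly p x\<bar> \<le> M"
    by (auto simp: bounded_pos)
  define C where "C = M * (real (m + 2) / c) ^ (m + 2)"
  show thesis
  proof
    show "C \<ge> 0" using M(1) assms by (simp add: C_def)
    fix x assume x: "a < x" "x < b"
    define q where "q = (x - a) * (b - x)"
    have q: "q > 0" using x by (simp add: q_def)
    have "\<bar>bump c a b p m x\<bar> = \<bar>poly p x\<bar> * exp (- c / q) / q ^ m"
      using x q by (simp add: bump_def q_def[symmetric] abs_mult)
    also have "\<dots> \<le> M * (real (m + 2) * q / c) ^ (m + 2) / q ^ m"
      using q M x assms
      by (intro divide_right_mono mult_mono exp_minus_divide_le_power) auto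
    also have "\<dots> = C * q\<^sup>2"
    proof -
      have "(real (m + 2) * q / c) ^ (m + 2) = (real (m + 2) / c) ^ (m + 2) * (q ^ m * q\<^sup>2)"
      proof -
        have "real (m + 2) * q / c = real (m + 2) / c * q" by simp
        then show ?thesis by (simp only: power_mult_distrib power_add) (simp only: mult_ac)
      qed
      moreover have "M * (R * (r * s)) / r = M * R * s" if "r \<noteq> 0" for R r s :: real
        using that by simp
      ultimately show ?thesis using q by (simp only: C_def) simp
    qed
    finally show "\<bar>bump c a b p m x\<bar> \<le> C * ((x - a) * (b - x))\<^sup>2" by (simp add: q_def)
  qed
qed

text \<open>
  Inside the interval this is a computation. At any other point the function is at most
  quadratic in the distance to that point, so both sides vanish.
\<close>

lemma bump_has_derivative:
  assumes "c > 0"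
  shows "(bump c a b p m has_real_derivative bump c a b (bump_deriv_poly c a b p m) (m + 2) x) (at x)"
proof (cases "a < x \<and> x < b")
  case True
  define Q where "Q = [:- a, 1:] * [:b, - 1 :: real:]"
  have Q_eq: "poly Q y = (y - a) * (b - y)" for y by (simp add: Q_def algebra_simps)
  have Qx: "poly Q x \<noteq> 0" using True by (simp add: Q_eq)
  have "((\<lambda>y. poly p y / poly Q y ^ m * exp (- c / poly Q y)) has_real_derivative
      (poly (pderiv p) x * poly Q x ^ m - poly p x * (real m * poly Q x ^ (m - 1) * poly (pderiv Q) x))
         / (poly Q x ^ m * poly Q x ^ m) * exp (- c / poly Q x)
      + poly p x / poly Q x ^ m * (exp (- c / poly Q x) * (c * poly (pderiv Q) x / (poly Q x * poly Q x)))) (at x)"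
    using Qx by (auto intro!: derivative_eq_intros simp: field_simps)
  also have "(poly (pderiv p) x * poly Q x ^ m - poly p x * (real m * poly Q x ^ (m - 1) * poly (pderiv Q) x))
         / (poly Q x ^ m * poly Q x ^ m) * exp (- c / poly Q x)
      + poly p x / poly Q x ^ m * (exp (- c / poly Q x) * (c * poly (pderiv Q) x / (poly Q x * poly Q x)))
      = poly (bump_deriv_poly c a b p m) x / poly Q x ^ (m + 2) * exp (- c / poly Q x)"
    unfolding bump_deriv_poly_def Let_def Q_def[symmetric] using Qx
    by (cases m) (simp_all add: field_simps power2_eq_square)
  finally have "((\<lambda>y. poly p y / poly Q y ^ m * exp (- c / poly Q y)) has_real_derivative
      bump c a b (bump_deriv_poly c a b p m) (m + 2) x) (at x)"
    using True by (simp add: bump_def Q_eq)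
  then show ?thesis
    by (rule has_field_derivative_transform_within_open[of _ _ _ "{a<..<b}"])
      (use True in \<open>auto simp: bump_def Q_eq\<close>)
next
  case False
  obtain C where C: "C \<ge> 0"
    "\<And>y. a < y \<Longrightarrow> y < b \<Longrightarrow> \<bar>bump c a b p m y\<bar> \<le> C * ((y - a) * (b - y))\<^sup>2"
    using bump_bound[OF assms] by metis
  define K where "K = C * (b - a)\<^sup>2"
  have quad: "\<bar>bump c a b p m (x + h)\<bar> \<le> K * h\<^sup>2" for h
  proof (cases "a < x + h \<and> x + h < b")
    case inside: True
    have "(x + h - a) * (b - (x + h)) \<le> (b - a) * \<bar>h\<bar>"
    proof (cases "x \<le> a")
      case True
      then have "(x + h - a) * (b - (x + h)) \<le> \<bar>h\<bar> * (b - a)"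
        using inside by (intro mult_mono) auto
      then show ?thesis by (simp add: mult.commute)
    next
      case *: False
      show ?thesis using inside False * by (intro mult_mono) auto
    qed
    then have "((x + h - a) * (b - (x + h)))\<^sup>2 \<le> ((b - a) * \<bar>h\<bar>)\<^sup>2"
      using inside by (intro power_mono) auto
    then have "C * ((x + h - a) * (b - (x + h)))\<^sup>2 \<le> K * h\<^sup>2"
      using C(1) by (simp add: K_def power_mult_distrib mult_left_mono mult.assoc)
    then show ?thesis using C(2)[of "x + h"] inside by linarith
  next
    case outside: False
    then show ?thesis using C(1) by (auto simp: bump_def K_def)
  qed
  have "((\<lambda>h. (bump c a b p m (x + h) - bump c a b p m x) / h) \<longlongrightarrow> 0) (at 0)"
  proof (rule Lim_null_comparison)
    show "((\<lambda>h. K * \<bar>h\<bar>) \<longlongrightarrow> 0) (at 0)"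
      by (auto intro!: tendsto_eq_intros)
    have "norm ((bump c a b p m (x + h) - bump c a b p m x) / h) \<le> K * \<bar>h\<bar>" if "h \<noteq> 0" for h
    proof -
      have "norm ((bump c a b p m (x + h) - bump c a b p m x) / h) = \<bar>bump c a b p m (x + h)\<bar> / \<bar>h\<bar>"
      proof -
        have "bump c a b p m x = 0" using False by (auto simp: bump_def)
        then show ?thesis by (simp add: abs_divide)
      qed
      also have "\<dots> \<le> K * h\<^sup>2 / \<bar>h\<bar>" by (intro divide_right_mono quad) auto
      also have "\<dots> = K * \<bar>h\<bar>" using that by (simp add: power2_eq_square abs_if)
      finally show ?thesis .
    qed
    then show "\<forall>\<^sub>F h in at 0. norm ((bump c a b p m (x + h) - bump c a b p m x) / h) \<le> K * \<bar>h\<bar>"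
      by (auto simp: eventually_at_filter)
  qed
  then have "(bump c a b p m has_real_derivative 0) (at x)" by (simp add: DERIV_def)
  moreover have "bump c a b (bump_deriv_poly c a b p m) (m + 2) x = 0"
    using False by (auto simp: bump_def)
  ultimately show ?thesis by simp
qed

text \<open>
  Numerators and exponents are chosen separately for each coordinate because a partial derivative
  changes a single factor; so the family is closed under partial derivatives.
\<close>

definition box_bump :: "real \<Rightarrow> real ^ 'd \<Rightarrow> real ^ 'd \<Rightarrow> ('d \<Rightarrow> real poly) \<Rightarrow> ('d \<Rightarrow> nat) \<Rightarrow> real ^ 'd \<Rightarrow> complex"
  where "box_bump c a b p m x = of_real (\<Prod>i\<in>UNIV. bump c (a $ i) (b $ i) (p i) (m i) (x $ i))"

lemma box_bump_has_derivative:
  fixes a b :: "real ^ 'd"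
  assumes "c > 0"
  shows "(box_bump c a b p m has_derivative
    (\<lambda>h. \<Sum>i\<in>UNIV. (h $ i) *\<^sub>R box_bump c a b
        (p(i := bump_deriv_poly c (a $ i) (b $ i) (p i) (m i))) (m(i := m i + 2)) x)) (at x)"
proof -
  define g where "g i = bump c (a $ i) (b $ i) (p i) (m i)" for i
  define g' where "g' i = bump c (a $ i) (b $ i) (bump_deriv_poly c (a $ i) (b $ i) (p i) (m i)) (m i + 2)" for i
  have "((\<lambda>x. g i (x $ i)) has_derivative (\<lambda>h. h $ i * g' i (x $ i))) (at x)" for i
  proof (rule has_derivative_compose[of "\<lambda>x. x $ i" "\<lambda>h. h $ i" x UNIV "g i" "\<lambda>h. h * g' i (x $ i)"])
    show "((\<lambda>x. x $ i) has_derivative (\<lambda>h. h $ i)) (at x)"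
      by (rule bounded_linear_imp_has_derivative) (rule bounded_linear_vec_nth)
    show "(g i has_derivative (\<lambda>h. h * g' i (x $ i))) (at (x $ i))"
      using bump_has_derivative[OF assms, of "a $ i" "b $ i" "p i" "m i" "x $ i"]
      unfolding g_def g'_def has_field_derivative_def
      by (rule has_derivative_eq_rhs) (simp add: fun_eq_iff)
  qed
  then have "((\<lambda>x. \<Prod>i\<in>UNIV. g i (x $ i)) has_derivative
      (\<lambda>h. \<Sum>i\<in>UNIV. h $ i * g' i (x $ i) * (\<Prod>j\<in>UNIV - {i}. g j (x $ j)))) (at x)"
    by (intro has_derivative_prod) auto
  then have "((\<lambda>x. of_real (\<Prod>i\<in>UNIV. g i (x $ i)) :: complex) has_derivative
      (\<lambda>h. of_real (\<Sum>i\<in>UNIV. h $ i * g' i (x $ i) * (\<Prod>j\<in>UNIV - {i}. g j (x $ j))))) (at x)"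
    by (rule has_derivative_of_real)
  moreover have "of_real (h $ i * g' i (x $ i) * (\<Prod>j\<in>UNIV - {i}. g j (x $ j)))
      = (h $ i) *\<^sub>R box_bump c a b
        (p(i := bump_deriv_poly c (a $ i) (b $ i) (p i) (m i))) (m(i := m i + 2)) x" for h :: "real ^ 'd" and i
    unfolding box_bump_def
    by (subst prod.remove[of _ i]) (auto simp: g_def g'_def scaleR_conv_of_real intro!: prod.cong)
  ultimately show ?thesis
    by (simp add: box_bump_def[abs_def] g_def of_real_sum)
qed

lemma partial_deriv_box_bump:
  assumes "c > 0"
  shows "partial_deriv i (box_bump c a b p m) =
    box_bump c a b (p(i := bump_deriv_poly c (a $ i) (b $ i) (p i) (m i))) (m(i := m i + 2))"
proof
  fix x
  have "partial_deriv i (box_bump c a b p m) x = (\<Sum>j\<in>UNIV. (axis i 1 $ j) *\<^sub>R box_bump c a b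
        (p(j := bump_deriv_poly c (a $ j) (b $ j) (p j) (m j))) (m(j := m j + 2)) x)"
    unfolding partial_deriv_def
    by (simp only: frechet_derivative_at[OF box_bump_has_derivative[OF assms], symmetric])
  also have "\<dots> = (\<Sum>j\<in>UNIV. if j = i then box_bump c a b
        (p(j := bump_deriv_poly c (a $ j) (b $ j) (p j) (m j))) (m(j := m j + 2)) x else 0)"
    by (intro sum.cong) (auto simp: axis_def)
  finally show "partial_deriv i (box_bump c a b p m) x =
    box_bump c a b (p(i := bump_deriv_poly c (a $ i) (b $ i) (p i) (m i))) (m(i := m i + 2)) x"
    by simp
qed

lemma box_bump_times_cont_diff:
  assumes "c > 0" shows "times_cont_diff k (box_bump c a b p m)"
proof (induction k arbitrary: p m)
  case 0
  show ?case
    using box_bump_has_derivative[OF assms, of a b p m]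
    by (auto intro!: continuous_at_imp_continuous_on has_derivative_continuous)
next
  case (Suc k)
  have "box_bump c a b p m differentiable_on UNIV"
    using box_bump_has_derivative[OF assms, of a b p m]
    by (auto simp: differentiable_on_def differentiable_def)
  then show ?case by (simp add: partial_deriv_box_bump[OF assms] Suc)
qed

lemma box_bump_outside: "x \<notin> box a b \<Longrightarrow> box_bump c a b p m x = 0"
  by (auto simp: box_bump_def mem_box_cart bump_def)

lemma box_bump_test_function:
  assumes "c > 0" shows "box_bump c a b p m \<in> test_functions"
proof -
  have "bounded {x. box_bump c a b p m x \<noteq> 0}"
    using box_bump_outside by (intro bounded_subset[OF bounded_box, of _ a b]) blast
  then show ?thesis
    by (simp add: test_functions_def box_bump_times_cont_diff[OF assms] bounded_closure
        compact_eq_bounded_closed)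
qed

lemma box_bump_norm_le_1:
  assumes "c > 0" shows "cmod (box_bump c a b (\<lambda>_. 1) (\<lambda>_. 0) x) \<le> 1"
proof -
  have "\<bar>bump c l u 1 0 y\<bar> \<le> 1" for l u y
    using assms by (auto simp: bump_def)
  then show ?thesis
    unfolding box_bump_def norm_of_real abs_prod by (intro prod_le_1) auto
qed

lemma box_bump_tendsto_indicator:
  "(\<lambda>n. box_bump (inverse (real (Suc n))) a b (\<lambda>_. 1) (\<lambda>_. 0) x)
     \<longlonglongrightarrow> indicator (box a b) x"
proof -
  have "(\<lambda>n. bump (inverse (real (Suc n))) l u 1 0 y) \<longlonglongrightarrow> indicator {l<..<u} y" for l u y
  proof (cases "y \<in> {l<..<u}")
    case True
    have "(\<lambda>n. exp (- inverse (real (Suc n)) / ((y - l) * (u - y)))) \<longlonglongrightarrow> exp (- 0 / ((y - l) * (u - y)))"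
      using True by (intro tendsto_intros LIMSEQ_inverse_real_of_nat) auto
    then show ?thesis using True by (simp add: bump_def)
  qed (auto simp: bump_def)
  then have "(\<lambda>n. \<Prod>i\<in>UNIV. bump (inverse (real (Suc n))) (a $ i) (b $ i) 1 0 (x $ i))
      \<longlonglongrightarrow> (\<Prod>i\<in>UNIV. indicator {a $ i<..<b $ i} (x $ i))"
    by (intro tendsto_prod) auto
  moreover have "(\<Prod>i\<in>UNIV. indicator {a $ i<..<b $ i} (x $ i)) = (indicator (box a b) x :: real)"
    by (auto simp: indicator_def mem_box_cart)
  ultimately have "(\<lambda>n. of_real (\<Prod>i\<in>UNIV. bump (inverse (real (Suc n))) (a $ i) (b $ i) 1 0 (x $ i)) :: complex)
      \<longlonglongrightarrow> of_real (indicator (box a b) x)"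
    by (intro tendsto_of_real) simp
  then show ?thesis by (cases "x \<in> box a b") (simp_all add: box_bump_def)
qed

section \<open>Square-integrable functions orthogonal to all test functions\<close>

text \<open>
  Boxes form a generating family of Borel sets that is stable under intersections, so the integral
  vanishes over every Borel set. Complements need the integral over the whole space, which is the limit
  over growing cubes.
\<close>

lemma integrable_box_integrals_zero_AE:
  fixes w :: "'a::euclidean_space \<Rightarrow> 'b::{banach, second_countable_topology}"
  assumes int: "integrable lborel w"
    and box: "\<And>a b. (\<integral>x. indicator (box a b) x *\<^sub>R w x \<partial>lborel) = 0"
  shows "AE x in lborel. w x = 0"
proof -
  let ?\<I> = "\<lambda>A. \<integral>x. indicator A x *\<^sub>R w x \<partial>lborel"
  have w[measurable]: "w \<in> borel_measurable borel"
    using int by auto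
  have total: "(\<integral>x. w x \<partial>lborel) = 0"
  proof -
    let ?B = "\<lambda>n::nat. box (- (real n *\<^sub>R One)) (real n *\<^sub>R One) :: 'a set"
    have "(\<lambda>n. ?\<I> (?B n)) \<longlonglongrightarrow> (\<integral>x. w x \<partial>lborel)"
    proof (rule integral_dominated_convergence)
      show "integrable lborel (\<lambda>x. norm (w x))" using int by simp
      show "AE x in lborel. (\<lambda>n. indicator (?B n) x *\<^sub>R w x) \<longlonglongrightarrow> w x"
      proof (rule AE_I2, rule tendsto_eventually)
        fix x :: 'a
        obtain n where n: "x \<in> ?B n" using UN_box_eq_UNIV by blast
        have "x \<in> ?B k" if "k \<ge> n" for k
          using n that by (force simp: mem_box)
        then show "\<forall>\<^sub>F k in sequentially. indicator (?B k) x *\<^sub>R w x = w x"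
          unfolding eventually_sequentially by (intro exI[of _ n]) simp
      qed
    qed (auto split: split_indicator)
    then show ?thesis using box LIMSEQ_unique[of "\<lambda>_. 0"] by (simp add: LIMSEQ_const_iff)
  qed
  have "?\<I> A = 0" if "A \<in> sets lborel" for A
  proof -
    have "Int_stable (range (\<lambda>(a, b). box a b :: 'a set))"
      by (auto simp: Int_stable_def box_Int_box)
    moreover have "range (\<lambda>(a, b). box a b :: 'a set) \<subseteq> Pow UNIV" by simp
    moreover have "A \<in> sigma_sets UNIV (range (\<lambda>(a, b). box a b :: 'a set))"
      using that by (simp add: borel_eq_box)
    ultimately show ?thesis
    proof (induction rule: sigma_sets_induct_disjoint)
      case (basic A) then show ?case using box by auto
    next
      case empty show ?case by simp
    next
      case (compl A)
      have [measurable]: "A \<in> sets borel" using compl(1) by (simp add: borel_eq_box)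
      have "?\<I> (UNIV - A) = (\<integral>x. w x - indicator A x *\<^sub>R w x \<partial>lborel)"
        by (intro Bochner_Integration.integral_cong) (auto split: split_indicator)
      also have "\<dots> = (\<integral>x. w x \<partial>lborel) - ?\<I> A"
        by (intro Bochner_Integration.integral_diff int integrable_mult_indicator) auto
      finally show ?case by (simp add: total compl)
    next
      case (union A)
      have [measurable]: "A i \<in> sets borel" for i using union(2) by (auto simp: borel_eq_box)
      have "set_lebesgue_integral lborel (\<Union>i. A i) w = (\<Sum>i. set_lebesgue_integral lborel (A i) w)"
        using int union(1)
        by (intro lebesgue_integral_countable_add)
          (auto simp: set_integrable_def disjoint_family_on_def intro!: integrable_mult_indicator)
      then show ?case by (simp add: set_lebesgue_integral_def union.IH)
    qed
  qed
  then show ?thesis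
    by (intro sigma_finite_measure.density_zero[OF sigma_finite_lborel int]) (simp add: set_lebesgue_integral_def)
qed

lemma L2_integrable_on_box:
  fixes w :: "real ^ 'd \<Rightarrow> complex"
  assumes "w \<in> L2"
  shows "integrable lborel (\<lambda>x. indicator (box a b) x *\<^sub>R w x)"
proof (rule Bochner_Integration.integrable_bound)
  have [measurable]: "w \<in> borel_measurable borel" using assms by (rule L2_measurable)
  show "(\<lambda>x. indicator (box a b) x *\<^sub>R w x) \<in> borel_measurable lborel" by measurable
  have "integrable lborel (indicator (box a b) :: real ^ 'd \<Rightarrow> real)"
    using emeasure_bounded_finite[OF bounded_box, of a b] by simp
  then show "integrable lborel (\<lambda>x. indicator (box a b) x + (cmod (w x))\<^sup>2)"
    using L2_integrable[OF assms] by simp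
  have "r \<le> 1 + r\<^sup>2" for r :: real
    using sum_squares_bound[of r 1] zero_le_power2[of r]
    unfolding power_one mult_1_right by linarith
  then show "AE x in lborel. norm (indicator (box a b) x *\<^sub>R w x)
      \<le> norm (indicator (box a b) x + (cmod (w x))\<^sup>2)"
    by (auto split: split_indicator)
qed

text \<open>
  Letting \<open>c\<close> tend to zero in the bumps shows that the integrals of \<open>w\<close> over all boxes vanish.
  As \<open>w\<close> is only locally integrable, it is cut off to growing cubes.
\<close>

lemma L2_orthogonal_test_functions_zero:
  fixes w :: "real ^ 'd \<Rightarrow> complex"
  assumes w: "w \<in> L2"
    and orth: "\<And>\<phi>. \<phi> \<in> test_functions \<Longrightarrow> (\<integral>x. w x * cnj (\<phi> x) \<partial>lborel) = 0"
  shows "ae_eq w (\<lambda>x. 0)"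
proof -
  have [measurable]: "w \<in> borel_measurable borel" using w by (rule L2_measurable)
  have box0: "(\<integral>x. indicator (box a b) x *\<^sub>R w x \<partial>lborel) = 0" for a b
  proof -
    define \<phi> where "\<phi> n = box_bump (inverse (real (Suc n))) a b (\<lambda>_. 1) (\<lambda>_. 0)" for n
    have \<phi>: "\<phi> n \<in> test_functions" for n
      unfolding \<phi>_def by (rule box_bump_test_function) simp
    have real: "cnj (\<phi> n x) = \<phi> n x" for n x by (simp add: \<phi>_def box_bump_def)
    have [measurable]: "\<phi> n \<in> borel_measurable borel" for n
      using box_bump_times_cont_diff[of "inverse (real (Suc n))" 0 a b "\<lambda>_. 1" "\<lambda>_. 0"]
      by (intro borel_measurable_continuous_onI) (simp add: \<phi>_def)
    have "(\<lambda>n. \<integral>x. w x * \<phi> n x \<partial>lborel) \<longlonglongrightarrow> (\<integral>x. indicator (box a b) x *\<^sub>R w x \<partial>lborel)"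
    proof (rule integral_dominated_convergence)
      show "integrable lborel (\<lambda>x. norm (indicator (box a b) x *\<^sub>R w x))"
        using L2_integrable_on_box[OF w] by (rule integrable_norm)
      show "AE x in lborel. (\<lambda>n. w x * \<phi> n x) \<longlonglongrightarrow> indicator (box a b) x *\<^sub>R w x"
      proof (rule AE_I2)
        fix x
        have "(\<lambda>n. w x * \<phi> n x) \<longlonglongrightarrow> w x * indicator (box a b) x"
          unfolding \<phi>_def by (intro tendsto_intros box_bump_tendsto_indicator)
        also have "w x * indicator (box a b) x = indicator (box a b) x *\<^sub>R w x"
          by (simp add: indicator_def)
        finally show "(\<lambda>n. w x * \<phi> n x) \<longlonglongrightarrow> indicator (box a b) x *\<^sub>R w x" .
      qed
      show "AE x in lborel. norm (w x * \<phi> n x) \<le> norm (indicator (box a b) x *\<^sub>R w x)" for n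
      proof (rule AE_I2)
        fix x
        show "norm (w x * \<phi> n x) \<le> norm (indicator (box a b) x *\<^sub>R w x)"
          using box_bump_norm_le_1[of "inverse (real (Suc n))" a b x] box_bump_outside[of x a b]
          by (cases "x \<in> box a b") (auto simp: \<phi>_def norm_mult intro!: mult_left_le)
      qed
    qed auto
    moreover have "(\<integral>x. w x * \<phi> n x \<partial>lborel) = 0" for n
      using orth[OF \<phi>[of n]] by (simp add: real)
    ultimately show ?thesis by (simp add: LIMSEQ_const_iff)
  qed
  let ?B = "\<lambda>n::nat. box (- (real n *\<^sub>R One)) (real n *\<^sub>R One) :: (real ^ 'd) set"
  have "AE x in lborel. indicator (?B n) x *\<^sub>R w x = 0" for n
  proof (rule integrable_box_integrals_zero_AE[OF L2_integrable_on_box[OF w]])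
    fix a b :: "real ^ 'd"
    have "(\<integral>x. indicator (box a b) x *\<^sub>R (indicator (?B n) x *\<^sub>R w x) \<partial>lborel)
        = (\<integral>x. indicator (box a b \<inter> ?B n) x *\<^sub>R w x \<partial>lborel)"
      by (intro Bochner_Integration.integral_cong) (auto split: split_indicator)
    then show "(\<integral>x. indicator (box a b) x *\<^sub>R (indicator (?B n) x *\<^sub>R w x) \<partial>lborel) = 0"
      by (simp only: box_Int_box box0)
  qed
  then have "AE x in lborel. \<forall>n. indicator (?B n) x *\<^sub>R w x = 0"
    unfolding AE_all_countable by blast
  then have "AE x in lborel. w x = 0"
  proof eventually_elim
    case (elim x)
    obtain n where "x \<in> ?B n" using UN_box_eq_UNIV by blast
    then show ?case using elim[rule_format, of n] by simp
  qed
  then show ?thesis by (simp add: ae_eq_def)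
qed

section \<open>Reflection and the magnetic Hamiltonian\<close>

text \<open>
  The scalar \<open>c\<close> absorbs the sign, so that the statement can be iterated for higher
  derivatives.
\<close>

lemma partial_deriv_scaled_reflect:
  fixes f :: "real ^ 'd \<Rightarrow> complex"
  assumes "f differentiable (at (- x))"
  shows "partial_deriv i (\<lambda>x. c * f (- x)) x = - c * partial_deriv i f (- x)"
proof -
  define D where "D = frechet_derivative f (at (- x))"
  have D: "(f has_derivative D) (at (- x))"
    using assms by (simp add: D_def frechet_derivative_works)
  have "((\<lambda>x. f (- x)) has_derivative (\<lambda>h. D (- h))) (at x)"
    by (rule has_derivative_compose[of uminus uminus x UNIV f D]) (auto intro: D derivative_eq_intros)
  then have "((\<lambda>x. c * f (- x)) has_derivative (\<lambda>h. c * D (- h))) (at x)"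
    by (rule bounded_linear.has_derivative[OF bounded_linear_mult_right])
  then have "partial_deriv i (\<lambda>x. c * f (- x)) x = c * D (- axis i 1)"
    unfolding partial_deriv_def by (simp add: frechet_derivative_at[symmetric])
  also have "D (- axis i 1) = - D (axis i 1)"
    using linear_neg[OF has_derivative_linear[OF D]] .
  finally show ?thesis by (simp add: D_def partial_deriv_def)
qed

lemma differentiable_scaled_reflect:
  fixes f :: "real ^ 'd \<Rightarrow> complex"
  assumes "f differentiable_on UNIV"
  shows "(\<lambda>x. c * f (- x)) differentiable_on UNIV"
proof -
  have "(\<lambda>x. f (- x)) differentiable (at x)" for x
    using assms differentiable_chain_at[of uminus x f]
    by (simp add: differentiable_on_def o_def)
  then show ?thesis by (auto simp: differentiable_on_def)
qed

lemma times_cont_diff_scaled_reflect: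
  "times_cont_diff k f \<Longrightarrow> times_cont_diff k (\<lambda>x. c * f (- x))"
proof (induction k arbitrary: f c)
  case 0
  then have "continuous_on UNIV (\<lambda>x. f (- x))"
    by (intro continuous_on_compose2[of UNIV f UNIV uminus] continuous_intros) auto
  then show ?case by (simp add: continuous_on_mult_left)
next
  case (Suc k)
  have "partial_deriv i (\<lambda>x. c * f (- x)) = (\<lambda>x. - c * partial_deriv i f (- x))" for i
    using Suc.prems by (intro ext partial_deriv_scaled_reflect) (simp add: differentiable_on_def)
  then show ?case
    using Suc.prems Suc.IH[of _ "- c"] differentiable_scaled_reflect[of f c]
    by (simp only: times_cont_diff.simps) simp
qed

lemma test_function_smooth: "\<phi> \<in> test_functions \<Longrightarrow> times_cont_diff k \<phi>"
  by (simp add: test_functions_def)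

lemma test_function_continuous: "\<phi> \<in> test_functions \<Longrightarrow> continuous_on UNIV \<phi>"
  using test_function_smooth[of \<phi> 0] by simp

lemma test_function_differentiable: "\<phi> \<in> test_functions \<Longrightarrow> \<phi> differentiable (at x)"
  using test_function_smooth[of \<phi> "Suc 0"] by (simp add: differentiable_on_def)

lemma partial_deriv_outside_support:
  assumes "x \<notin> closure {y. f y \<noteq> 0}"
  shows "partial_deriv i f x = 0"
proof -
  have "((\<lambda>y. 0) has_derivative (\<lambda>h. 0)) (at x)" by simp
  then have "(f has_derivative (\<lambda>h. 0)) (at x)"
  proof (rule has_derivative_transform_within_open)
    show "open (- closure {y. f y \<noteq> 0})" "x \<in> - closure {y. f y \<noteq> 0}"
      using assms by auto
    show "0 = f y" if "y \<in> - closure {y. f y \<noteq> 0}" for y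
      using that closure_subset[of "{y. f y \<noteq> 0}"] by auto
  qed
  then show ?thesis unfolding partial_deriv_def by (simp add: frechet_derivative_at[symmetric])
qed

lemma test_function_partial_deriv:
  assumes "\<phi> \<in> test_functions" shows "partial_deriv i \<phi> \<in> test_functions"
proof -
  have "{x. partial_deriv i \<phi> x \<noteq> 0} \<subseteq> closure {x. \<phi> x \<noteq> 0}"
    using partial_deriv_outside_support by blast
  moreover have "bounded (closure {x. \<phi> x \<noteq> 0})"
    using assms by (auto simp: test_functions_def compact_imp_bounded)
  ultimately have "bounded {x. partial_deriv i \<phi> x \<noteq> 0}" by (rule bounded_subset[rotated])
  moreover have "times_cont_diff k (partial_deriv i \<phi>)" for k
    using test_function_smooth[OF assms, of "Suc k"] by simp
  ultimately show ?thesis by (simp add: test_functions_def)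
qed

lemma test_function_reflect:
  assumes "\<phi> \<in> test_functions" shows "reflect \<phi> \<in> test_functions"
proof -
  have "{x. \<phi> (- x) \<noteq> 0} = uminus ` {x. \<phi> x \<noteq> 0}"
    by (auto simp: image_iff) (metis minus_minus)
  then have "bounded {x. \<phi> (- x) \<noteq> 0}"
    using assms by (simp add: test_functions_def)
  moreover have "times_cont_diff k (\<lambda>x. \<phi> (- x))" for k
    using times_cont_diff_scaled_reflect[OF test_function_smooth[OF assms], of k 1] by simp
  ultimately show ?thesis by (simp add: test_functions_def reflect_def)
qed

lemma divergence_linear:
  fixes A :: "real ^ 'd \<Rightarrow> real ^ 'd"
  assumes "bounded_linear A"
  shows "divergence A x = (\<Sum>i\<in>UNIV. A (axis i 1) $ i)"
proof -
  have "bounded_linear (\<lambda>y. A y $ i)" for i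
    using bounded_linear_compose[OF bounded_linear_vec_nth assms] .
  then show ?thesis
    unfolding divergence_def partial_deriv_def
    by (simp add: frechet_derivative_at[OF bounded_linear_imp_has_derivative, symmetric])
qed

text \<open>
  The second-order part is even, the first-order part is the product of the two odd objects \<open>A\<close>
  and \<open>\<nabla>\<close>, and the coefficients \<open>|A|\<^sup>2\<close>, \<open>div A\<close>, \<open>|x|\<^sup>2\<close> are even.
\<close>

lemma hamiltonian_reflect:
  assumes A: "bounded_linear A" and \<phi>: "\<phi> \<in> test_functions"
  shows "hamiltonian A c (reflect \<phi>) = reflect (hamiltonian A c \<phi>)"
proof
  fix x
  have 1: "partial_deriv i (reflect \<phi>) = (\<lambda>x. - 1 * partial_deriv i \<phi> (- x))" for i
    using partial_deriv_scaled_reflect[OF test_function_differentiable[OF \<phi>], of i 1]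
    by (auto simp: reflect_def)
  have 2: "partial_deriv i (partial_deriv i (reflect \<phi>)) x = partial_deriv i (partial_deriv i \<phi>) (- x)" for i
    unfolding 1
    by (subst partial_deriv_scaled_reflect)
      (auto intro: test_function_differentiable test_function_partial_deriv \<phi>)
  have A_odd: "A (- x) = - A x" using A by (simp add: linear_neg bounded_linear.linear)
  show "hamiltonian A c (reflect \<phi>) x = reflect (hamiltonian A c \<phi>) x"
    unfolding hamiltonian_def neg_magnetic_laplacian_def laplacian_def 2 reflect_def[of "hamiltonian A c \<phi>"]
    unfolding 1 divergence_linear[OF A] A_odd hamiltonian_def neg_magnetic_laplacian_def laplacian_def
    by (simp add: reflect_def)
qed

lemma closed_hamiltonian_reflect:
  assumes A: "bounded_linear A" and fg: "(f, g) \<in> closed_hamiltonian A c"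
  shows "(reflect f, reflect g) \<in> closed_hamiltonian A c"
proof -
  obtain \<phi> where \<phi>: "\<And>n::nat. \<phi> n \<in> test_functions"
    and lim: "(\<lambda>n. L2_dist (\<phi> n) f) \<longlonglongrightarrow> 0" "(\<lambda>n. L2_dist (hamiltonian A c (\<phi> n)) g) \<longlonglongrightarrow> 0"
    and "f \<in> L2" "g \<in> L2"
    using fg by (auto simp: closed_hamiltonian_def)
  moreover have "(\<lambda>n. L2_dist (reflect (\<phi> n)) (reflect f)) \<longlonglongrightarrow> 0"
    using lim(1) by (simp add: L2_dist_reflect)
  moreover have "(\<lambda>n. L2_dist (hamiltonian A c (reflect (\<phi> n))) (reflect g)) \<longlonglongrightarrow> 0"
    using lim(2) by (simp add: L2_dist_reflect hamiltonian_reflect[OF A \<phi>])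
  ultimately show ?thesis
    unfolding closed_hamiltonian_def
    by (auto intro!: L2_reflect exI[of _ "\<lambda>n. reflect (\<phi> n)"] test_function_reflect)
qed

lemma continuous_compact_support_L2:
  fixes f :: "real ^ 'd \<Rightarrow> complex"
  assumes "continuous_on UNIV f" "compact K" "\<And>x. x \<notin> K \<Longrightarrow> f x = 0"
  shows "f \<in> L2"
proof -
  have "integrable lborel (\<lambda>x. indicator K x *\<^sub>R (cmod (f x))\<^sup>2)"
    using assms(1) by (intro borel_integrable_compact assms(2) continuous_intros)
      (rule continuous_on_subset, auto)
  also have "(\<lambda>x. indicator K x *\<^sub>R (cmod (f x))\<^sup>2) = (\<lambda>x. (cmod (f x))\<^sup>2)"
    using assms(3) by (auto simp: fun_eq_iff split: split_indicator)
  finally show ?thesis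
    using assms(1) by (simp add: L2_def borel_measurable_continuous_onI)
qed

text \<open>
  This puts test functions into the domain of the generator. What has to be checked is that \<open>\<phi>\<close>
  and its image under the Hamiltonian are square-integrable: both are continuous and vanish outside
  the compact support of \<open>\<phi>\<close>.
\<close>

lemma test_function_closed_hamiltonian:
  fixes \<phi> :: "real ^ 'd \<Rightarrow> complex"
  assumes A: "bounded_linear A" and \<phi>: "\<phi> \<in> test_functions"
  shows "(\<phi>, hamiltonian A c \<phi>) \<in> closed_hamiltonian A c"
proof -
  define K where "K = closure {x. \<phi> x \<noteq> 0}"
  have K: "compact K" using \<phi> by (simp add: K_def test_functions_def)
  have out: "\<phi> x = 0" "partial_deriv i \<phi> x = 0" "partial_deriv i (partial_deriv i \<phi>) x = 0"
    if "x \<notin> K" for x i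
  proof -
    show "\<phi> x = 0" using that closure_subset[of "{x. \<phi> x \<noteq> 0}"] by (auto simp: K_def)
    show "partial_deriv i \<phi> x = 0" using that by (simp add: K_def partial_deriv_outside_support)
    have "{x. partial_deriv i \<phi> x \<noteq> 0} \<subseteq> K"
      using partial_deriv_outside_support[of _ \<phi> i] by (auto simp: K_def)
    then have "closure {x. partial_deriv i \<phi> x \<noteq> 0} \<subseteq> K"
      by (simp add: K_def closure_minimal)
    then show "partial_deriv i (partial_deriv i \<phi>) x = 0"
      using that by (intro partial_deriv_outside_support) auto
  qed
  have cont: "continuous_on UNIV \<phi>" "continuous_on UNIV (partial_deriv i \<phi>)"
    "continuous_on UNIV (partial_deriv i (partial_deriv i \<phi>))" for i
    by (intro test_function_continuous test_function_partial_deriv \<phi>)+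
  have A_cont: "continuous_on UNIV A" by (intro linear_continuous_on A)
  have "hamiltonian A c \<phi> \<in> L2"
  proof (rule continuous_compact_support_L2[OF _ K])
    show "continuous_on UNIV (hamiltonian A c \<phi>)"
      unfolding hamiltonian_def[abs_def] neg_magnetic_laplacian_def laplacian_def divergence_linear[OF A]
      by (intro continuous_intros cont A_cont)
    show "hamiltonian A c \<phi> x = 0" if "x \<notin> K" for x
      by (simp add: hamiltonian_def neg_magnetic_laplacian_def laplacian_def out[OF that])
  qed
  moreover have "\<phi> \<in> L2"
    by (rule continuous_compact_support_L2[OF cont(1) K out(1)])
  moreover have "L2_dist f f = 0" for f :: "real ^ 'd \<Rightarrow> complex"
    by (simp add: L2_dist_def L2_norm_def)
  ultimately show ?thesis
    using \<phi> unfolding closed_hamiltonian_def by (auto intro!: exI[of _ "\<lambda>_. \<phi>"])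
qed

section \<open>Parity is preserved by the evolution\<close>

lemma schroedinger_group_preserves_even:
  assumes A: "bounded_linear A" and U: "is_schroedinger_group A c U"
    and f: "f \<in> L2" "ae_eq (reflect f) f"
  shows "ae_eq (reflect (U t f)) (U t f)"
proof -
  interpret one_parameter_unitary_group U
    using U by unfold_locales (simp add: is_schroedinger_group_def)
  have gen: "self_adjoint_generator U = closed_hamiltonian A c"
    using U by (simp add: is_schroedinger_group_def)
  have "ae_eq (\<lambda>x. U t f x - reflect (U t f) x) (\<lambda>x. 0)"
  proof (rule L2_orthogonal_test_functions_zero)
    show "(\<lambda>x. U t f x - reflect (U t f) x) \<in> L2"
      by (intro L2_diff L2_reflect U_L2 f)
    show "(\<integral>x. (U t f x - reflect (U t f) x) * cnj (\<phi> x) \<partial>lborel) = 0" if "\<phi> \<in> test_functions" for \<phi>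
      using even_part_orthogonal[of \<phi> "hamiltonian A c \<phi>" f t] closed_hamiltonian_reflect[OF A, of _ _ c]
        test_function_closed_hamiltonian[OF A that, of c] f gen by blast
  qed
  then show ?thesis by (auto simp: ae_eq_def elim: AE_mp)
qed

text \<open>
  By induction over the switching times: on each interval a single group acts on the state at the
  left end point.
\<close>

lemma solution_preserves_even:
  assumes A: "bounded_linear A" and sol: "is_solution A T u \<psi>0 \<psi>" and even: "ae_eq (reflect \<psi>0) \<psi>0"
  shows "ae_eq (reflect (\<psi> T)) (\<psi> T)"
proof -
  obtain n \<tau> c where pieces: "is_pieces T u n \<tau> c"
    and step: "\<And>i. i < n \<Longrightarrow> \<exists>U. is_schroedinger_group A (c i) U \<and>
           (\<forall>t\<in>{\<tau> i..\<tau> (Suc i)}. ae_eq (\<psi> t) (U (t - \<tau> i) (\<psi> (\<tau> i))))"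
    using sol by (auto simp: is_solution_def)
  have \<tau>: "\<tau> 0 = 0" "\<tau> n = T" "\<And>i. i < n \<Longrightarrow> \<tau> i < \<tau> (Suc i)"
    using pieces by (auto simp: is_pieces_def)
  have mono: "\<tau> i \<le> \<tau> j" if "i \<le> j" "j \<le> n" for i j
    using that
  proof (induction j rule: dec_induct)
    case (step j) then show ?case using \<tau>(3)[of j] by simp
  qed simp
  have "ae_eq (reflect (\<psi> (\<tau> i))) (\<psi> (\<tau> i))" if "i \<le> n" for i
    using that
  proof (induction i)
    case 0
    have "ae_eq (\<psi> 0) \<psi>0" using sol by (simp add: is_solution_def)
    from ae_eq_trans[OF ae_eq_trans[OF ae_eq_reflect[OF this] even] ae_eq_sym[OF this]]
    show ?case by (simp add: \<tau>(1))
  next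
    case (Suc i)
    obtain U where U: "is_schroedinger_group A (c i) U"
      "\<forall>t\<in>{\<tau> i..\<tau> (Suc i)}. ae_eq (\<psi> t) (U (t - \<tau> i) (\<psi> (\<tau> i)))"
      using step[of i] Suc.prems by auto
    have "\<tau> i \<in> {0..T}" using mono[of 0 i] mono[of i n] Suc.prems \<tau> by auto
    then have "\<psi> (\<tau> i) \<in> L2" using sol by (simp add: is_solution_def L2_sphere_def)
    then have even_U: "ae_eq (reflect (U (\<tau> (Suc i) - \<tau> i) (\<psi> (\<tau> i)))) (U (\<tau> (Suc i) - \<tau> i) (\<psi> (\<tau> i)))"
      using Suc by (intro schroedinger_group_preserves_even[OF A U(1)]) auto
    have eq: "ae_eq (\<psi> (\<tau> (Suc i))) (U (\<tau> (Suc i) - \<tau> i) (\<psi> (\<tau> i)))"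
      using U(2) \<tau>(3)[of i] Suc.prems by simp
    show ?case
      by (rule ae_eq_trans[OF ae_eq_trans[OF ae_eq_reflect[OF eq] even_U] ae_eq_sym[OF eq]])
  qed
  then show ?thesis using \<tau>(2) by auto
qed

section \<open>Failure of approximate controllability\<close>

text \<open>
  The vectors \<open>f + g\<close> and \<open>f - g\<close> have the same norm, and their difference is \<open>2 g\<close>.
\<close>

lemma even_odd_L2_dist:
  assumes "f \<in> L2" "g \<in> L2" "ae_eq (reflect f) f" "ae_eq (reflect g) (\<lambda>x. - g x)"
  shows "L2_norm g \<le> L2_dist f g"
proof -
  have eq: "L2_norm (\<lambda>x. f x + g x) = L2_norm (\<lambda>x. f x - g x)"
    by (rule L2_norm_add_eq_diff[OF assms])
  have "L2_norm (\<lambda>x. (f x + g x) - (f x - g x))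
      \<le> L2_norm (\<lambda>x. f x + g x) + L2_norm (\<lambda>x. f x - g x)"
    by (intro L2_norm_triangle_minus L2_add L2_diff assms)
  then have "L2_norm (\<lambda>x. 2 * g x) \<le> 2 * L2_dist f g"
    unfolding eq L2_dist_def by simp
  then show ?thesis unfolding L2_norm_mult by simp
qed

definition unit_cube :: "(real ^ 'd) set" where
  "unit_cube = box (vec (- 1 / 2)) (vec (1 / 2))"

lemma unit_cube_reflect: "- x \<in> unit_cube \<longleftrightarrow> x \<in> unit_cube"
  unfolding unit_cube_def mem_box_cart by (simp add: conj_commute minus_less_iff less_minus_iff) 

lemma measure_unit_cube: "measure lborel (unit_cube :: (real ^ 'd) set) = 1"
proof -
  have "(vec (1 / 2) - vec (- 1 / 2) :: real ^ 'd) \<bullet> e = 1" if "e \<in> Basis" for e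
    using that by (auto simp: Basis_vec_def inner_axis)
  moreover have "vec (- 1 / 2) \<bullet> e \<le> (vec (1 / 2) :: real ^ 'd) \<bullet> e" if "e \<in> Basis" for e
    using that by (auto simp: Basis_vec_def inner_axis)
  ultimately show ?thesis
    unfolding unit_cube_def by (subst measure_lborel_box) auto
qed

text \<open>
  Source of explicit unit vectors: the cube has volume one, \<open>s = 1\<close> gives an even state and the
  sign of a coordinate an odd one.
\<close>

lemma unimodular_on_unit_cube_in_sphere:
  fixes s :: "real ^ 'd \<Rightarrow> complex"
  assumes [measurable]: "s \<in> borel_measurable borel" and s: "AE x in lborel. cmod (s x) = 1"
  shows "(\<lambda>x. s x * indicator unit_cube x) \<in> L2_sphere"
proof -
  have [measurable]: "(unit_cube :: (real ^ 'd) set) \<in> sets borel" by (simp add: unit_cube_def)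
  have ae: "AE x in lborel. indicator unit_cube x = (cmod (s x * indicator unit_cube x))\<^sup>2"
    using s by eventually_elim (auto simp: norm_mult split: split_indicator)
  have int: "integrable lborel (indicator unit_cube :: real ^ 'd \<Rightarrow> real)"
    using emeasure_lborel_box_finite[of "vec (- 1 / 2) :: real ^ 'd" "vec (1 / 2)"]
    by (simp add: unit_cube_def)
  have "(\<lambda>x. s x * indicator unit_cube x) \<in> L2"
    unfolding L2_def using integrable_cong_AE_imp[OF int _ ae] by simp
  moreover have "(\<integral>x. (cmod (s x * indicator unit_cube x))\<^sup>2 \<partial>lborel)
      = (\<integral>x. indicator (unit_cube :: (real ^ 'd) set) x \<partial>lborel)"
    using ae by (intro integral_cong_AE) auto
  then have "L2_norm (\<lambda>x. s x * indicator unit_cube x) = 1"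
    by (simp add: L2_norm_def measure_unit_cube)
  ultimately show ?thesis by (simp add: L2_sphere_def)
qed

lemma AE_coordinate_nonzero: "AE x in lborel. (x :: real ^ 'd) $ k \<noteq> 0"
proof -
  have "negligible {x :: real ^ 'd. x $ k = 0}" by (rule negligible_standard_hyperplane_cart)
  moreover have "{x :: real ^ 'd. x $ k = 0} \<in> sets lborel"
    by simp
  ultimately have "{x :: real ^ 'd. x $ k = 0} \<in> null_sets lborel"
    by (simp add: negligible_iff_null_sets null_sets_completion_iff)
  then show ?thesis by (rule AE_I') auto
qed

text \<open>
  An odd target of norm one is at distance at least one from every state reachable from an even
  initial state.
\<close>

theorem linear_potential_not_controllable:
  fixes A :: "real ^ 'd \<Rightarrow> real ^ 'd"
  assumes A: "bounded_linear A"
  shows "\<not> approximately_controllable A"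
proof
  assume ctrl: "approximately_controllable A"
  \<comment> \<open>Any coordinate serves to define an odd state.\<close>
  define k where "k = (undefined :: 'd)"
  define \<psi>0 :: "real ^ 'd \<Rightarrow> complex" where "\<psi>0 = (\<lambda>x. 1 * indicator unit_cube x)"
  define \<psi>1 :: "real ^ 'd \<Rightarrow> complex"
    where "\<psi>1 = (\<lambda>x. of_real (sgn (x $ k)) * indicator unit_cube x)"
  have "\<psi>0 \<in> L2_sphere"
    unfolding \<psi>0_def by (rule unimodular_on_unit_cube_in_sphere) auto
  moreover have \<psi>1: "\<psi>1 \<in> L2_sphere"
    unfolding \<psi>1_def
  proof (rule unimodular_on_unit_cube_in_sphere)
    show "(\<lambda>x :: real ^ 'd. complex_of_real (sgn (x $ k))) \<in> borel_measurable borel"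
      by measurable
    show "AE x :: real ^ 'd in lborel. cmod (of_real (sgn (x $ k))) = 1"
      using AE_coordinate_nonzero[of k] by eventually_elim (simp add: sgn_if)
  qed
  ultimately obtain T \<theta> u \<psi> where "T \<ge> 0" and sol: "is_solution A T u \<psi>0 \<psi>"
    and close: "L2_dist (\<psi> T) (\<lambda>x. exp (\<i> * of_real \<theta>) * \<psi>1 x) < 1"
    using ctrl unfolding approximately_controllable_def by (metis zero_less_one)
  have "ae_eq (reflect \<psi>0) \<psi>0"
    by (simp add: \<psi>0_def reflect_def ae_eq_def unit_cube_reflect indicator_def)
  then have even: "ae_eq (reflect (\<psi> T)) (\<psi> T)"
    by (rule solution_preserves_even[OF A sol])
  have odd: "ae_eq (reflect (\<lambda>x. exp (\<i> * of_real \<theta>) * \<psi>1 x)) (\<lambda>x. - (exp (\<i> * of_real \<theta>) * \<psi>1 x))"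
    by (simp add: \<psi>1_def reflect_def ae_eq_def unit_cube_reflect indicator_def sgn_minus)
  have "\<psi> T \<in> L2" using sol \<open>T \<ge> 0\<close> by (simp add: is_solution_def L2_sphere_def)
  then have "L2_norm (\<lambda>x. exp (\<i> * of_real \<theta>) * \<psi>1 x) \<le> L2_dist (\<psi> T) (\<lambda>x. exp (\<i> * of_real \<theta>) * \<psi>1 x)"
    using \<psi>1 by (intro even_odd_L2_dist L2_mult even odd) (auto simp: L2_sphere_def)
  moreover have "L2_norm (\<lambda>x. exp (\<i> * of_real \<theta>) * \<psi>1 x) = 1"
    using \<psi>1 by (simp add: L2_norm_mult L2_sphere_def)
  ultimately show False using close by simp
qed

theorem theorem3:
  fixes b :: real and b3 :: "real ^ 3"
  shows "\<not> approximately_controllable (\<lambda>x :: real ^ 2. b *\<^sub>R vector [- (x $ 2), x $ 1]) \<and>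
         \<not> approximately_controllable (\<lambda>x :: real ^ 3. cross3 x b3)"
proof
  have "linear (\<lambda>x :: real ^ 2. b *\<^sub>R vector [- (x $ 2), x $ 1] :: real ^ 2)"
    by (rule linearI) (simp_all add: vec_eq_iff forall_2 algebra_simps)
  then show "\<not> approximately_controllable (\<lambda>x :: real ^ 2. b *\<^sub>R vector [- (x $ 2), x $ 1])"
    by (intro linear_potential_not_controllable) (simp add: linear_conv_bounded_linear)
  have "linear (\<lambda>x :: real ^ 3. cross3 x b3)"
    by (rule linearI) (simp_all add: cross_add_left cross_mult_left)
  then show "\<not> approximately_controllable (\<lambda>x :: real ^ 3. cross3 x b3)"
    by (intro linear_potential_not_controllable) (simp add: linear_conv_bounded_linear)
qed

end
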